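(* Let $p>1$ and let $k\geq r\geq 3$ be integers. For every $\varepsilon>0$ there are $\delta=\delta(k,r,\varepsilon)>0$ and $n_0=n_0(k,r,\varepsilon)$ such that for all $n>n_0$: if $H$ is an $n$-vertex $H_{k+1}^{(r)}$-free $r$-graph with \[ \lambda^{(p)}(H)>(1-\delta)\frac{(k)_r}{k^r}n^{r(1-1/p)}, \] then $H$ can be transformed to $T_r(n,k)$ by adding and deleting at most $\varepsilon\binom{n}{r}$ edges.
   Context: An $r$-graph is an $r$-uniform hypergraph. For an $r$-graph $H$ on vertex set $[n]$ and real $p\geq1$, $\lambda^{(p)}(H)=\max_{\bm{x}\in\mathbb{R}^n,\ \|\bm{x}\|_p=1} r!\sum_{e\in E(H)}\prod_{v\in e}x_v$. $(k)_r=k(k-1)\cdots(k-r+1)$. $T_r(n,k)$ is the complete $k$-partite $r$-graph on $n$ vertices with part sizes differing by at most one (edges: all $r$-sets with at most one vertex in each part). $H_{k+1}^{(r)}$ is obtained from the complete graph $K_{k+1}$ by enlarging each edge with a new set of $r-2$ vertices, these sets pairwise disjoint and disjoint from $V(K_{k+1})$. $H$ is $F$-free if it has no subgraph isomorphic to $F$.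
   Formalization: Here δ and n_0 may depend on p as well as on k, r, ε; independence of p is false, since T_r(n/2,k) plus n/2 isolated vertices satisfies the spectral hypothesis for p close to 1 but is far from T_r(n,k). *)

theory Defs
  imports "HOL-Analysis.Analysis"
begin

definition r_graph :: "nat \<Rightarrow> 'a set \<Rightarrow> 'a set set \<Rightarrow> bool" where
  "r_graph r V E \<longleftrightarrow> finite V \<and> (\<forall>e\<in>E. e \<subseteq> V \<and> card e = r)"

definition subgraph :: "'a set \<Rightarrow> 'a set set \<Rightarrow> 'a set \<Rightarrow> 'a set set \<Rightarrow> bool" where
  "subgraph V' E' V E \<longleftrightarrow> V' \<subseteq> V \<and> E' \<subseteq> E \<and> (\<forall>e\<in>E'. e \<subseteq> V')"

definition hypergraph_iso :: "'a set \<Rightarrow> 'a set set \<Rightarrow> 'b set \<Rightarrow> 'b set set \<Rightarrow> bool" where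
  "hypergraph_iso V E W F \<longleftrightarrow> (\<exists>f. bij_betw f V W \<and> (`) f ` E = F)"

definition hypergraph_free ::
    "'b set \<Rightarrow> 'b set set \<Rightarrow> 'a set \<Rightarrow> 'a set set \<Rightarrow> bool" where
  "hypergraph_free W F V E \<longleftrightarrow>
     \<not> (\<exists>V' E'. subgraph V' E' V E \<and> hypergraph_iso W F V' E')"

text \<open>The expanded clique \<open>H\<^sub>t\<^sup>(\<^sup>r\<^sup>)\<close>: the vertices of \<open>K\<^sub>t\<close> are \<open>Inl i\<close> for \<open>i < t\<close>, and
  the \<open>r - 2\<close> new vertices that enlarge the edge \<open>d\<close> of \<open>K\<^sub>t\<close> are \<open>Inr (d, j)\<close> for
  \<open>j < r - 2\<close>.\<close>

type_synonym exp_vertex = "nat + nat set \<times> nat"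

definition clique_edges :: "nat \<Rightarrow> nat set set" where
  "clique_edges t = {d. d \<subseteq> {..<t} \<and> card d = 2}"

definition exp_clique_verts :: "nat \<Rightarrow> nat \<Rightarrow> exp_vertex set" where
  "exp_clique_verts r t = Inl ` {..<t} \<union> Inr ` (clique_edges t \<times> {..<r - 2})"

definition exp_clique_edges :: "nat \<Rightarrow> nat \<Rightarrow> exp_vertex set set" where
  "exp_clique_edges r t =
     (\<lambda>d. Inl ` d \<union> (\<lambda>j. Inr (d, j)) ` {..<r - 2}) ` clique_edges t"

text \<open>\<open>is_turan_graph r k V T\<close>: the edge set \<open>T\<close> makes \<open>V\<close> a copy of \<open>T\<^sub>r(|V|, k)\<close>.\<close>

definition is_turan_graph :: "nat \<Rightarrow> nat \<Rightarrow> 'a set \<Rightarrow> 'a set set \<Rightarrow> bool" where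
  "is_turan_graph r k V T \<longleftrightarrow>
     (\<exists>A :: nat \<Rightarrow> 'a set.
        disjoint_family_on A {..<k} \<and> (\<Union>i<k. A i) = V \<and>
        (\<forall>i<k. \<forall>j<k. card (A i) \<le> card (A j) + 1) \<and>
        T = {e. e \<subseteq> V \<and> card e = r \<and> (\<forall>i<k. card (e \<inter> A i) \<le> 1)})"

definition lp_norm_on :: "'a set \<Rightarrow> real \<Rightarrow> ('a \<Rightarrow> real) \<Rightarrow> real" where
  "lp_norm_on V p x = (\<Sum>v\<in>V. \<bar>x v\<bar> powr p) powr (1 / p)"

definition poly_form :: "nat \<Rightarrow> 'a set set \<Rightarrow> ('a \<Rightarrow> real) \<Rightarrow> real" where
  "poly_form r E x = fact r * (\<Sum>e\<in>E. \<Prod>v\<in>e. x v)"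

text \<open>Only the values of \<open>x\<close> on \<open>V\<close> matter, so \<open>x\<close> stands for a vector indexed by \<open>V\<close>.
  The supremum is a maximum by \<open>p_spectral_radius_attained\<close> below.\<close>

definition p_spectral_radius :: "real \<Rightarrow> nat \<Rightarrow> 'a set \<Rightarrow> 'a set set \<Rightarrow> real" where
  "p_spectral_radius p r V E = (SUP x\<in>{x. lp_norm_on V p x = 1}. poly_form r E x)"

definition falling_fact :: "nat \<Rightarrow> nat \<Rightarrow> real" where
  "falling_fact k r = (\<Prod>i<r. real k - real i)"

lemma lp_norm_on_eq_1_iff:
  assumes "p \<ge> 1"
  shows "lp_norm_on V p x = 1 \<longleftrightarrow> (\<Sum>v\<in>V. \<bar>x v\<bar> powr p) = 1"
proof -
  define s where "s = (\<Sum>v\<in>V. \<bar>x v\<bar> powr p)"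
  have "s \<ge> 0" unfolding s_def by (intro sum_nonneg) auto
  then have "(s powr (1 / p)) powr p = s" using assms by (simp add: powr_powr)
  then have "s powr (1 / p) = 1 \<longleftrightarrow> s = 1" by (metis powr_one_eq_one)
  then show ?thesis by (simp add: lp_norm_on_def s_def)
qed

lemma p_spectral_radius_attained:
  fixes V :: "'a set"
  assumes "p \<ge> 1" "r_graph r V E" "V \<noteq> {}"
  obtains x where "lp_norm_on V p x = 1" "poly_form r E x = p_spectral_radius p r V E"
    "\<And>y. lp_norm_on V p y = 1 \<Longrightarrow> poly_form r E y \<le> p_spectral_radius p r V E"
proof -
  have fin: "finite V" and sub: "\<And>e. e \<in> E \<Longrightarrow> e \<subseteq> V"
    using assms(2) by (auto simp: r_graph_def)
  define B :: "'a \<Rightarrow> real set" where "B = (\<lambda>v. if v \<in> V then {-1..1} else {0})"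
  define S where "S = {x \<in> PiE UNIV B. (\<Sum>v\<in>V. \<bar>x v\<bar> powr p) = 1}"
  have "compactin (product_topology (\<lambda>_. euclidean) UNIV) (PiE UNIV B)"
    by (subst compactin_PiE) (auto simp: B_def)
  then have cK: "compact (PiE UNIV B)"
    by (simp add: euclidean_product_topology)
  have cont: "continuous_on UNIV (\<lambda>x::'a \<Rightarrow> real. \<Sum>v\<in>V. \<bar>x v\<bar> powr p)"
    using assms(1)
    by (intro continuous_intros continuous_on_powr' continuous_on_product_coordinates) auto
  have "closed {x::'a \<Rightarrow> real. (\<Sum>v\<in>V. \<bar>x v\<bar> powr p) = 1}"
    by (rule closed_Collect_eq[OF cont]) (rule continuous_on_const)
  from compact_Int_closed[OF cK this] have cS: "compact S"
    by (simp add: S_def Int_def)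
  obtain v0 where v0: "v0 \<in> V" using assms(3) by blast
  have "(\<lambda>v. if v = v0 then 1 else 0) \<in> S"
  proof -
    have "(\<Sum>v\<in>V. \<bar>if v = v0 then 1 else 0::real\<bar> powr p) = (\<Sum>v\<in>V. if v = v0 then 1 else 0)"
      by (intro sum.cong) auto
    also have "\<dots> = 1" using fin v0 by simp
    finally show ?thesis using v0 by (auto simp: S_def B_def)
  qed
  then have "S \<noteq> {}" by blast
  moreover have "continuous_on S (poly_form r E)"
    unfolding poly_form_def
    by (intro continuous_intros continuous_on_subset[OF continuous_on_product_coordinates]) auto
  ultimately obtain x where x: "x \<in> S" "\<And>y. y \<in> S \<Longrightarrow> poly_form r E y \<le> poly_form r E x"
    using continuous_attains_sup[OF cS] by blast
  have x1: "lp_norm_on V p x = 1"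
    using x(1) assms(1) by (simp add: S_def lp_norm_on_eq_1_iff)
  have le: "poly_form r E y \<le> poly_form r E x" if y: "lp_norm_on V p y = 1" for y
  proof -
    define z where "z = (\<lambda>v. if v \<in> V then y v else 0)"
    have s: "(\<Sum>v\<in>V. \<bar>y v\<bar> powr p) = 1"
      using y assms(1) by (simp add: lp_norm_on_eq_1_iff)
    have b: "\<bar>y v\<bar> \<le> 1" if "v \<in> V" for v
    proof (rule ccontr)
      assume a: "\<not> \<bar>y v\<bar> \<le> 1"
      have "\<bar>y v\<bar> powr p \<le> 1"
        using member_le_sum[OF that, of "\<lambda>v. \<bar>y v\<bar> powr p"] fin s by simp
      moreover have "\<bar>y v\<bar> powr p > 1"
        using a assms(1) by (intro gr_one_powr) auto
      ultimately show False by simp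
    qed
    have "(\<Sum>v\<in>V. \<bar>z v\<bar> powr p) = 1"
      using s by (simp add: z_def cong: sum.cong)
    then have "z \<in> S"
      using b by (fastforce simp: S_def B_def z_def abs_le_iff)
    moreover have "poly_form r E z = poly_form r E y"
      unfolding poly_form_def z_def using sub
      by (intro arg_cong[where f = "(*) _"] sum.cong prod.cong refl) auto
    ultimately show ?thesis using x(2) by metis
  qed
  have "p_spectral_radius p r V E = poly_form r E x"
    unfolding p_spectral_radius_def
    by (rule cSup_eq_maximum) (use x1 le in auto)
  with x1 le that show ?thesis by metis
qed

end

theory Submission
  imports Defs
begin

text \<open>Deleting \<open>O(n ^ (r - 1))\<close> edges makes every pair of vertices either uncovered or of
  codegree so large that a clique of the shadow graph expands greedily to a copy of the expanded
  clique; hence the shadow \<open>G\<close> of the remaining \<open>r\<close>-graph \<open>E'\<close> has no \<open>(k + 1)\<close>-clique.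
  By Hoelder's inequality and \<open>p > 1\<close> the deleted edges contribute a lower order term to
  the \<open>p\<close>-spectral radius. The contribution of \<open>E'\<close> is at most
  \<open>r! |E'| powr (1 - 1/p)\<close> times the \<open>p\<close>-th root of a weighted count of the \<open>r\<close>-cliques of \<open>G\<close>,
  which the weighted Moon-Moser inequality bounds by \<open>(k)\<^sub>r / (r! k\<^sup>r)\<close>. So \<open>E'\<close> has almost as many
  edges as the Turan \<open>r\<close>-graph, and the Moon-Moser ratios, now with unit weights, force
  \<open>G\<close> to have almost as many edges as the Turan graph. Furedi's partition argument
  makes \<open>G\<close> nearly \<open>k\<close>-partite with nearly equal parts, and moving few vertices balances them.\<close>

section \<open>Weighted clique counts\<close>

definition cliques :: "('a \<Rightarrow> 'a \<Rightarrow> bool) \<Rightarrow> 'a set \<Rightarrow> nat \<Rightarrow> 'a set set" where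
  "cliques adj V s = {S. S \<subseteq> V \<and> card S = s \<and> (\<forall>u\<in>S. \<forall>v\<in>S. u \<noteq> v \<longrightarrow> adj u v)}"

text \<open>Removing \<open>T\<close> explicitly makes every member a genuinely new vertex even for
  a reflexive \<open>adj\<close>, such as the constantly true relation that later handles the
  deleted edges.\<close>

definition common_nbrs :: "('a \<Rightarrow> 'a \<Rightarrow> bool) \<Rightarrow> 'a set \<Rightarrow> 'a set \<Rightarrow> 'a set" where
  "common_nbrs adj V T = {u \<in> V - T. \<forall>v\<in>T. adj v u}"

definition clique_weight :: "('a \<Rightarrow> 'a \<Rightarrow> bool) \<Rightarrow> 'a set \<Rightarrow> ('a \<Rightarrow> real) \<Rightarrow> nat \<Rightarrow> real" where
  "clique_weight adj V y s = (\<Sum>S\<in>cliques adj V s. \<Prod>v\<in>S. y v)"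

lemma finite_cliques: "finite V \<Longrightarrow> finite (cliques adj V s)"
  by (rule finite_subset[of _ "Pow V"]) (auto simp: cliques_def)

lemma finite_common_nbrs: "finite V \<Longrightarrow> finite (common_nbrs adj V T)"
  by (auto simp: common_nbrs_def)

text \<open>Both sides run over the same flags: \<open>(T, u)\<close> corresponds to
  \<open>(insert u T, u)\<close>. The summand is left arbitrary, so the exchange serves for degree
  sums, second moments and plain counting.\<close>

lemma sum_cliques_Suc:
  fixes g :: "'a set \<Rightarrow> 'a \<Rightarrow> 'b::comm_monoid_add"
  assumes fin: "finite V" and sym: "\<And>u v. adj u v \<Longrightarrow> adj v u"
  shows "(\<Sum>T\<in>cliques adj V s. \<Sum>u\<in>common_nbrs adj V T. g T u)
       = (\<Sum>A\<in>cliques adj V (Suc s). \<Sum>a\<in>A. g (A - {a}) a)"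
proof -
  have fc: "finite A" if "A \<in> cliques adj V t" for A t
    using that fin by (auto simp: cliques_def intro: finite_subset)
  have "(\<Sum>T\<in>cliques adj V s. \<Sum>u\<in>common_nbrs adj V T. g T u)
      = (\<Sum>(T,u)\<in>Sigma (cliques adj V s) (common_nbrs adj V). g T u)"
    using fin by (intro sum.Sigma) (auto simp: finite_cliques finite_common_nbrs)
  also have "\<dots> = (\<Sum>(A,a)\<in>(SIGMA A:cliques adj V (Suc s). A). g (A - {a}) a)"
  proof (rule sum.reindex_bij_witness[of _ "\<lambda>(A,a). (A - {a}, a)" "\<lambda>(T,u). (insert u T, u)"])
    fix z assume "z \<in> Sigma (cliques adj V s) (common_nbrs adj V)"
    then obtain T u where z: "z = (T,u)" "T \<in> cliques adj V s" "u \<in> common_nbrs adj V T" by auto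
    have "finite T" using fc z by blast
    then have "insert u T \<in> cliques adj V (Suc s)"
      using z sym by (auto simp: cliques_def common_nbrs_def)
    then show "(case z of (T,u) \<Rightarrow> (insert u T, u)) \<in> (SIGMA A:cliques adj V (Suc s). A)"
      using z by auto
    show "(case case z of (T,u) \<Rightarrow> (insert u T, u) of (A,a) \<Rightarrow> (A - {a}, a)) = z"
      using z by (auto simp: common_nbrs_def)
    show "(case case z of (T,u) \<Rightarrow> (insert u T, u) of (A,a) \<Rightarrow> g (A - {a}) a)
        = (case z of (T,u) \<Rightarrow> g T u)"
      using z by (auto simp: common_nbrs_def)
  next
    fix z assume "z \<in> (SIGMA A:cliques adj V (Suc s). A)"
    then obtain A a where z: "z = (A,a)" "A \<in> cliques adj V (Suc s)" "a \<in> A" by auto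
    have "finite A" using fc z by blast
    then have "A - {a} \<in> cliques adj V s" "a \<in> common_nbrs adj V (A - {a})"
      using z by (auto simp: cliques_def common_nbrs_def)
    then show "(case z of (A,a) \<Rightarrow> (A - {a}, a)) \<in> Sigma (cliques adj V s) (common_nbrs adj V)"
      using z by auto
    show "(case case z of (A,a) \<Rightarrow> (A - {a}, a) of (T,u) \<Rightarrow> (insert u T, u)) = z"
      using z by auto
  qed
  also have "\<dots> = (\<Sum>A\<in>cliques adj V (Suc s). \<Sum>a\<in>A. g (A - {a}) a)"
    using fin fc by (subst sum.Sigma) (auto simp: finite_cliques)
  finally show ?thesis .
qed

text \<open>This is \<open>(k choose r) / k ^ r\<close>: the number of transversal
  \<open>r\<close>-sets of \<open>k\<close> parts of size \<open>n / k\<close>, divided by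
  \<open>n ^ r\<close>.\<close>

definition turan_density :: "nat \<Rightarrow> nat \<Rightarrow> real" where
  "turan_density k r = falling_fact k r / (fact r * real k ^ r)"

text \<open>The factors are the ratios of consecutive clique weights in
  \<open>clique_weight_ratio_le\<close>, with \<open>N\<close> in the place of the total
  weight.\<close>

lemma turan_density_eq:
  "(\<Prod>i<r. (real k - real i) / (real (Suc i) * real k) * N) = turan_density k r * N ^ r"
  unfolding turan_density_def falling_fact_def
  by (induction r) (auto simp: field_simps)

lemma turan_density_pos: "r \<le> k \<Longrightarrow> 0 < k \<Longrightarrow> 0 < turan_density k r"
  unfolding turan_density_def falling_fact_def by (intro divide_pos_pos prod_pos mult_pos_pos) auto

locale weighted_graph =
  fixes V :: "'a set" and adj :: "'a \<Rightarrow> 'a \<Rightarrow> bool" and y :: "'a \<Rightarrow> real"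
  assumes fin: "finite V" and sym: "\<And>u v. adj u v \<Longrightarrow> adj v u"
    and nonneg: "\<And>v. v \<in> V \<Longrightarrow> 0 \<le> y v"
begin

lemma prod_clique_nonneg: "S \<in> cliques adj V s \<Longrightarrow> 0 \<le> (\<Prod>v\<in>S. y v)"
  using nonneg by (intro prod_nonneg) (auto simp: cliques_def)

lemma clique_weight_nonneg: "0 \<le> clique_weight adj V y s"
  unfolding clique_weight_def by (intro sum_nonneg prod_clique_nonneg)

lemma clique_weight_0: "clique_weight adj V y 0 = 1"
proof -
  have "cliques adj V 0 = {{}}"
    using fin by (auto simp: cliques_def card_eq_0_iff dest: finite_subset)
  then show ?thesis by (simp add: clique_weight_def)
qed

lemma prod_minus_clique:
  assumes "A \<in> cliques adj V s" "a \<in> A"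
  shows "(\<Prod>v\<in>A - {a}. y v) * y a = (\<Prod>v\<in>A. y v)"
proof -
  have "finite A" using assms fin by (auto simp: cliques_def intro: finite_subset)
  then show ?thesis using assms(2) by (simp add: prod.remove mult.commute)
qed

text \<open>Each clique of size \<open>s + 1\<close> is reached once from each of its
  \<open>s + 1\<close> facets.\<close>

lemma sum_clique_degrees:
  "(\<Sum>T\<in>cliques adj V s. (\<Prod>v\<in>T. y v) * sum y (common_nbrs adj V T))
   = real (Suc s) * clique_weight adj V y (Suc s)"
proof -
  have "(\<Sum>T\<in>cliques adj V s. (\<Prod>v\<in>T. y v) * sum y (common_nbrs adj V T))
     = (\<Sum>T\<in>cliques adj V s. \<Sum>u\<in>common_nbrs adj V T. (\<Prod>v\<in>T. y v) * y u)"
    by (simp add: sum_distrib_left)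
  also have "\<dots> = (\<Sum>A\<in>cliques adj V (Suc s). \<Sum>a\<in>A. (\<Prod>v\<in>A - {a}. y v) * y a)"
    by (rule sum_cliques_Suc[OF fin sym])
  also have "\<dots> = (\<Sum>A\<in>cliques adj V (Suc s). \<Sum>a\<in>A. (\<Prod>v\<in>A. y v))"
    by (intro sum.cong refl prod_minus_clique)
  also have "\<dots> = (\<Sum>A\<in>cliques adj V (Suc s). real (Suc s) * (\<Prod>v\<in>A. y v))"
    by (intro sum.cong refl) (auto simp: cliques_def)
  finally show ?thesis by (simp add: clique_weight_def sum_distrib_left)
qed

text \<open>A vertex outside \<open>A\<close> that is joined to two different sets \<open>A - {a}\<close> is joined to all of \<open>A\<close>.\<close>
lemma sum_common_nbrs_facets_le:
  assumes A: "A \<in> cliques adj V (Suc s)"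
  shows "(\<Sum>a\<in>A. sum y (common_nbrs adj V (A - {a}))) \<le> sum y V + real s * sum y (common_nbrs adj V A)"
proof -
  have fA: "finite A" and cA: "card A = Suc s" and AV: "A \<subseteq> V"
    using A fin by (auto simp: cliques_def intro: finite_subset)
  define I where "I = (\<lambda>T v. if v \<in> common_nbrs adj V T then 1 else 0 :: real)"
  have eq: "sum y (common_nbrs adj V T) = (\<Sum>v\<in>V. y v * I T v)" for T
  proof -
    have "(\<Sum>v\<in>V. y v * I T v) = (\<Sum>v\<in>V. if v \<in> common_nbrs adj V T then y v else 0)"
      by (intro sum.cong) (auto simp: I_def)
    also have "\<dots> = sum y (V \<inter> common_nbrs adj V T)"
      by (rule sum.inter_restrict[OF fin, symmetric])
    also have "V \<inter> common_nbrs adj V T = common_nbrs adj V T" by (auto simp: common_nbrs_def)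
    finally show ?thesis ..
  qed
  have pt: "(\<Sum>a\<in>A. I (A - {a}) v) \<le> 1 + real s * I A v" if v: "v \<in> V" for v
  proof (cases "v \<in> common_nbrs adj V A")
    case True
    then have "(\<Sum>a\<in>A. I (A - {a}) v) \<le> (\<Sum>a\<in>A. 1)" by (intro sum_mono) (auto simp: I_def)
    then show ?thesis using True cA by (simp add: I_def)
  next
    case False
    \<comment> \<open>This includes \<open>v\<close> in \<open>A\<close>: such a vertex avoids
      \<open>A - {a}\<close> only for \<open>a = v\<close>.\<close>
    have uniq: "a = b" if "a \<in> A" "b \<in> A" "v \<in> common_nbrs adj V (A - {a})"
      "v \<in> common_nbrs adj V (A - {b})" for a b
      using that False by (auto simp: common_nbrs_def)
    have "(\<Sum>a\<in>A. I (A - {a}) v) \<le> 1"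
    proof (cases "\<exists>b\<in>A. v \<in> common_nbrs adj V (A - {b})")
      case True
      then obtain b where b: "b \<in> A" "v \<in> common_nbrs adj V (A - {b})" by blast
      have "(\<Sum>a\<in>A. I (A - {a}) v) = (\<Sum>a\<in>A. if a = b then 1 else 0)"
        
      proof (intro sum.cong refl)
        fix a assume "a \<in> A"
        then show "I (A - {a}) v = (if a = b then 1 else 0)"
          using uniq[of a b] b by (cases "v \<in> common_nbrs adj V (A - {a})") (auto simp: I_def)
      qed
      then show ?thesis using b fA by simp
    next
      case False
      then have "(\<Sum>a\<in>A. I (A - {a}) v) = 0" by (intro sum.neutral) (auto simp: I_def)
      then show ?thesis by simp
    qed
    then show ?thesis by (simp add: I_def False)
  qed
  have "(\<Sum>a\<in>A. sum y (common_nbrs adj V (A - {a}))) = (\<Sum>a\<in>A. \<Sum>v\<in>V. y v * I (A - {a}) v)"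
    by (simp add: eq)
  also have "\<dots> = (\<Sum>v\<in>V. y v * (\<Sum>a\<in>A. I (A - {a}) v))"
    by (subst sum.swap) (simp add: sum_distrib_left)
  also have "\<dots> \<le> (\<Sum>v\<in>V. y v * (1 + real s * I A v))"
    by (intro sum_mono mult_left_mono pt nonneg)
  also have "\<dots> = sum y V + real s * sum y (common_nbrs adj V A)"
    by (simp add: eq distrib_left sum.distrib sum_distrib_left mult.left_commute[of "y _"])
  finally show ?thesis .
qed

text \<open>Cauchy-Schwarz bounds the squared first moment of the degrees \<open>d T\<close>,
  weighted by \<open>w T\<close>, by the total weight times the second moment. Exchanging flags
  turns the second moment into a sum over \<open>(s + 1)\<close>-cliques of the degrees of their
  facets, where \<open>sum_common_nbrs_facets_le\<close> applies.\<close>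

lemma moon_moser_weighted:
  "(real (Suc s) * clique_weight adj V y (Suc s))\<^sup>2
   \<le> clique_weight adj V y s * (sum y V * clique_weight adj V y (Suc s)
        + real s * real (s + 2) * clique_weight adj V y (s + 2))"
proof -
  define d where "d = (\<lambda>T. sum y (common_nbrs adj V T))"
  define w where "w = (\<lambda>T. \<Prod>v\<in>T. y v)"
  let ?C = "\<lambda>s. cliques adj V s"
  have "(\<Sum>T\<in>?C s. w T * d T * d T) = (\<Sum>T\<in>?C s. \<Sum>u\<in>common_nbrs adj V T. w T * y u * d T)"
    by (intro sum.cong refl)
      (simp add: d_def sum_distrib_left sum_distrib_right mult.assoc mult.commute mult.left_commute)
  also have "\<dots> = (\<Sum>A\<in>?C (Suc s). \<Sum>a\<in>A. w (A - {a}) * y a * d (A - {a}))"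
    by (rule sum_cliques_Suc[OF fin sym])
  also have "\<dots> = (\<Sum>A\<in>?C (Suc s). \<Sum>a\<in>A. w A * d (A - {a}))"
    by (intro sum.cong refl) (simp add: prod_minus_clique w_def)
  also have "\<dots> = (\<Sum>A\<in>?C (Suc s). w A * (\<Sum>a\<in>A. d (A - {a})))"
    by (simp add: sum_distrib_left)
  also have "\<dots> \<le> (\<Sum>A\<in>?C (Suc s). w A * (sum y V + real s * d A))"
    by (intro sum_mono mult_left_mono)
      (auto simp: d_def w_def sum_common_nbrs_facets_le prod_clique_nonneg)
  also have "\<dots> = sum y V * clique_weight adj V y (Suc s) + real s * (\<Sum>A\<in>?C (Suc s). w A * d A)"
    by (simp add: distrib_left sum.distrib sum_distrib_left clique_weight_def w_def
        mult.left_commute mult.commute)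
  also have "(\<Sum>A\<in>?C (Suc s). w A * d A) = real (s + 2) * clique_weight adj V y (s + 2)"
    using sum_clique_degrees[of "Suc s"] by (simp add: w_def d_def)
  finally have sq: "(\<Sum>T\<in>?C s. w T * d T * d T) \<le> sum y V * clique_weight adj V y (Suc s)
        + real s * real (s + 2) * clique_weight adj V y (s + 2)" by (simp add: mult.assoc)
  have w0: "0 \<le> w T" if "T \<in> ?C s" for T using prod_clique_nonneg[OF that] by (simp add: w_def)
  have "(real (Suc s) * clique_weight adj V y (Suc s))\<^sup>2 = (\<Sum>T\<in>?C s. w T * d T)\<^sup>2"
    using sum_clique_degrees[of s] by (simp add: w_def d_def)
  also have "\<dots> = (\<Sum>T\<in>?C s. sqrt (w T) * (sqrt (w T) * d T))\<^sup>2"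
    using w0 by (intro arg_cong[where f = "\<lambda>x. x\<^sup>2"] sum.cong refl) (simp add: mult.assoc[symmetric])
  also have "\<dots> \<le> (\<Sum>T\<in>?C s. (sqrt (w T))\<^sup>2) * (\<Sum>T\<in>?C s. (sqrt (w T) * d T)\<^sup>2)"
    by (rule Cauchy_Schwarz_ineq_sum)
  also have "(\<Sum>T\<in>?C s. (sqrt (w T))\<^sup>2) = clique_weight adj V y s"
    using w0 by (simp add: clique_weight_def w_def cong: sum.cong)
  also have "(\<Sum>T\<in>?C s. (sqrt (w T) * d T)\<^sup>2) = (\<Sum>T\<in>?C s. w T * d T * d T)"
    using w0 by (intro sum.cong refl) (simp add: power_mult_distrib power2_eq_square[of "d _"])
  also have "clique_weight adj V y s * \<dots> \<le> clique_weight adj V y s * (sum y V * clique_weight adj V y (Suc s)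
        + real s * real (s + 2) * clique_weight adj V y (s + 2))"
    by (intro mult_left_mono sq clique_weight_nonneg)
  finally show ?thesis .
qed

text \<open>Downward induction on \<open>s\<close>: at \<open>s = k\<close> the ratio is 0 because
  there is no \<open>(k + 1)\<close>-clique, and the Moon-Moser inequality carries a bound on the
  ratio from level \<open>s + 1\<close> down to level \<open>s\<close>.\<close>

lemma clique_weight_ratio_le:
  assumes "cliques adj V (Suc k) = {}" "0 < k" "s \<le> k"
  shows "clique_weight adj V y (Suc s)
    \<le> (real k - real s) / (real (Suc s) * real k) * sum y V * clique_weight adj V y s"
  using assms(3)
proof (induction s rule: inc_induct)
  case base
  then show ?case using assms(1) by (simp add: clique_weight_def)
next
  case (step s)
  let ?K = "clique_weight adj V y"
  let ?N = "sum y V"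
  have N: "0 \<le> ?N" using nonneg by (intro sum_nonneg)
  \<comment> \<open>This identity is what lets the induction reproduce the same formula one level
    lower.\<close>
  have cs: "1 + real s * ((real k - real (Suc s)) / real k) = real (Suc s) * (real k - real s) / real k"
    using assms(2) by (simp add: field_simps)
  show ?case
  \<comment> \<open>The argument ends by cancelling \<open>?K (Suc s)\<close>; if that weight
    vanishes, nonnegativity of the right-hand side suffices.\<close>
  proof (cases "?K (Suc s) = 0")
    case True
    then show ?thesis using step.hyps N clique_weight_nonneg by simp
  next
    case False
    then have pos: "?K (Suc s) > 0" using clique_weight_nonneg[of "Suc s"] by simp
    have "real (s + 2) * ?K (s + 2) \<le> real (s + 2) *
        ((real k - real (Suc s)) / (real (s + 2) * real k) * ?N * ?K (Suc s))"
      using step.IH by (intro mult_left_mono) simp_all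
    also have "\<dots> = (real k - real (Suc s)) / real k * ?N * ?K (Suc s)"
      by (simp del: of_nat_add of_nat_Suc)
    finally have "real (s + 2) * ?K (s + 2) \<le> (real k - real (Suc s)) / real k * ?N * ?K (Suc s)" .
    then have "real s * (real (s + 2) * ?K (s + 2)) \<le> real s * ((real k - real (Suc s)) / real k * ?N * ?K (Suc s))"
      by (intro mult_left_mono) auto
    then have "?N * ?K (Suc s) + real s * real (s + 2) * ?K (s + 2)
      \<le> (1 + real s * ((real k - real (Suc s)) / real k)) * ?N * ?K (Suc s)"
      by (simp add: algebra_simps)
    then have "(real (Suc s) * ?K (Suc s))\<^sup>2 \<le> ?K s * (real (Suc s) * (real k - real s) / real k * ?N * ?K (Suc s))"
      using moon_moser_weighted[of s] clique_weight_nonneg[of s] unfolding cs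
      by (meson mult_left_mono order_trans)
    then have "(real (Suc s) * ?K (Suc s)) * (real (Suc s) * ?K (Suc s))
      \<le> (?K s * ((real k - real s) / real k * ?N)) * (real (Suc s) * ?K (Suc s))"
      by (simp add: power2_eq_square mult_ac)
    then have "real (Suc s) * ?K (Suc s) \<le> ?K s * ((real k - real s) / real k * ?N)"
      by (rule mult_right_le_imp_le) (use pos in simp)
    then have "?K (Suc s) \<le> ?K s * ((real k - real s) / real k * ?N) / real (Suc s)"
      by (subst pos_le_divide_eq) (simp_all add: mult.commute)
    then show ?thesis by (simp add: mult_ac)
  qed
qed

text \<open>Stated relative to level \<open>s\<close>, so that one lemma gives both the upper bound on \<open>r\<close>-cliques
  (\<open>s = 0\<close>) and the transfer of near-extremality from \<open>r\<close>-cliques to edges (\<open>s = 2\<close>).\<close>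
lemma clique_weight_le:
  assumes "cliques adj V (Suc k) = {}" "0 < k" "s \<le> r" "r \<le> k"
  shows "clique_weight adj V y r
    \<le> (\<Prod>i=s..<r. (real k - real i) / (real (Suc i) * real k) * sum y V) * clique_weight adj V y s"
  using assms(3,4)
proof (induction r rule: dec_induct)
  case base
  then show ?case by simp
next
  case (step t)
  have N: "0 \<le> sum y V" using nonneg by (intro sum_nonneg)
  let ?c = "(real k - real t) / (real (Suc t) * real k) * sum y V"
  have "clique_weight adj V y (Suc t) \<le> ?c * clique_weight adj V y t"
    using clique_weight_ratio_le[OF assms(1,2), of t] step.prems by simp
  also have "\<dots> \<le> ?c * ((\<Prod>i=s..<t. (real k - real i) / (real (Suc i) * real k) * sum y V) * clique_weight adj V y s)"
    using step N by (intro mult_left_mono) auto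
  finally show ?case using step.hyps by (simp add: mult_ac)
qed

text \<open>The ratios telescope down to the empty clique, of weight 1. For \<open>r = 2\<close> and
  total weight 1 this is the Motzkin-Straus bound.\<close>

lemma clique_weight_le_turan:
  assumes "cliques adj V (Suc k) = {}" "0 < k" "r \<le> k"
  shows "clique_weight adj V y r \<le> turan_density k r * sum y V ^ r"
  using clique_weight_le[OF assms(1,2), of 0 r] assms(3)
  by (simp add: turan_density_eq[symmetric] atLeast0LessThan clique_weight_0)

text \<open>A crude bound that holds for every graph; it is meant for the deleted edges, whose
  shadow may contain large cliques.\<close>

lemma clique_weight_le_power: "clique_weight adj V y s \<le> sum y V ^ s"
proof (induction s)
  case 0
  show ?case using clique_weight_0 by simp
next
  case (Suc s)
  have N: "0 \<le> sum y V" using nonneg by (intro sum_nonneg)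
  have "1 * clique_weight adj V y (Suc s) \<le> real (Suc s) * clique_weight adj V y (Suc s)"
    by (intro mult_right_mono clique_weight_nonneg) auto
  also have "\<dots> = (\<Sum>T\<in>cliques adj V s. (\<Prod>v\<in>T. y v) * sum y (common_nbrs adj V T))"
    using sum_clique_degrees by simp
  also have "\<dots> \<le> (\<Sum>T\<in>cliques adj V s. (\<Prod>v\<in>T. y v) * sum y V)"
    by (intro sum_mono mult_left_mono sum_mono2 fin prod_clique_nonneg)
      (auto simp: common_nbrs_def nonneg)
  also have "\<dots> = clique_weight adj V y s * sum y V"
    by (simp add: clique_weight_def sum_distrib_right)
  also have "\<dots> \<le> sum y V ^ s * sum y V" using Suc N by (intro mult_right_mono)
  finally show ?case by (simp add: mult.commute)
qed

end

lemma clique_weight_one: "clique_weight adj V (\<lambda>_. 1) s = real (card (cliques adj V s))"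
  by (simp add: clique_weight_def)

section \<open>Partitions of graphs without large cliques\<close>

text \<open>The last colour class consists of the non-neighbours of a vertex \<open>x\<close> of maximum degree: each
  of its vertices has at most as many neighbours as there are vertices outside the class.\<close>
lemma furedi_partition:
  fixes adj :: "'a \<Rightarrow> 'a \<Rightarrow> bool"
  assumes sym: "\<And>u v. adj u v \<Longrightarrow> adj v u" and irrefl: "\<And>u. \<not> adj u u"
    and "finite V" and "cliques adj V (Suc k) = {}"
  shows "\<exists>c :: 'a \<Rightarrow> nat. c ` V \<subseteq> {..<k} \<and>
    card {(u,v)\<in>V\<times>V. adj u v} + card {(u,v)\<in>V\<times>V. adj u v \<and> c u = c v}
      \<le> card {(u,v)\<in>V\<times>V. c u \<noteq> c v}"
  using assms(3,4)
proof (induction k arbitrary: V)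
  case 0
  have "V = {}"
  proof (rule ccontr)
    assume "V \<noteq> {}"
    then obtain v where "v \<in> V" by blast
    then have "{v} \<in> cliques adj V (Suc 0)" by (auto simp: cliques_def)
    then show False using 0 by simp
  qed
  then show ?case by simp
next
  case (Suc k)
  show ?case
  proof (cases "V = {}")
    case True
    then show ?thesis by simp
  next
    case False
    define deg where "deg = (\<lambda>u. card {v\<in>V. adj u v})"
    obtain x where x: "x \<in> V" "\<And>u. u \<in> V \<Longrightarrow> deg u \<le> deg x"
      using Max_in[of "deg ` V"] Max_ge[of "deg ` V"] Suc.prems(1) False by fastforce
    define W where "W = {v\<in>V. adj x v}"
    define U where "U = V - W"
    have fV: "finite V" and fW: "finite W" and fU: "finite U"
      using Suc.prems by (auto simp: W_def U_def)
    have VUW: "V = U \<union> W" "U \<inter> W = {}" by (auto simp: U_def W_def)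
    have "cliques adj W (Suc k) = {}"
    proof (rule ccontr)
      assume "cliques adj W (Suc k) \<noteq> {}"
      then obtain S where S: "S \<in> cliques adj W (Suc k)" by blast
      then have "finite S" "x \<notin> S" using fW irrefl by (auto simp: cliques_def W_def intro: finite_subset)
      then have "insert x S \<in> cliques adj V (Suc (Suc k))"
        using S x(1) sym by (auto simp: cliques_def W_def)
      then show False using Suc.prems by simp
    qed
    from Suc.IH[OF fW this] obtain c where c: "c ` W \<subseteq> {..<k}"
      "card {(u,v)\<in>W\<times>W. adj u v} + card {(u,v)\<in>W\<times>W. adj u v \<and> c u = c v}
        \<le> card {(u,v)\<in>W\<times>W. c u \<noteq> c v}" by blast
    \<comment> \<open>On \<open>W\<close> only colours below \<open>k\<close> occur, so
      \<open>k\<close> is a fresh colour for \<open>U\<close>, the class containing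
      \<open>x\<close>.\<close>
    define c' where "c' = (\<lambda>v. if v \<in> W then c v else k)"
    have ck: "c v < k" if "v \<in> W" for v using c(1) that by auto
    have ck': "c v \<noteq> k" "k \<noteq> c v" if "v \<in> W" for v using ck[OF that] by auto
    have WV: "v \<in> V" if "v \<in> W" for v using that by (simp add: W_def)
    have fin: "finite {(u,v)\<in>A\<times>B. P u v}" if "finite A" "finite B" for A B and P :: "'a \<Rightarrow> 'a \<Rightarrow> bool"
      by (rule finite_subset[of _ "A \<times> B"]) (use that in auto)
    have swap: "card {(u,v)\<in>W\<times>U. adj u v} = card {(u,v)\<in>U\<times>W. adj u v}"
      by (rule bij_betw_same_card[of prod.swap]) (auto simp: bij_betw_def inj_on_def image_def sym)
    have e1: "card {(u,v)\<in>V\<times>V. adj u v}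
      = card {(u,v)\<in>W\<times>W. adj u v} + card {(u,v)\<in>U\<times>W. adj u v} + card {(u,v)\<in>U\<times>V. adj u v}"
    proof -
      have "{(u,v)\<in>V\<times>V. adj u v}
        = ({(u,v)\<in>W\<times>W. adj u v} \<union> {(u,v)\<in>W\<times>U. adj u v}) \<union> {(u,v)\<in>U\<times>V. adj u v}"
        using VUW by auto
      also have "card \<dots> = card {(u,v)\<in>W\<times>W. adj u v} + card {(u,v)\<in>W\<times>U. adj u v} + card {(u,v)\<in>U\<times>V. adj u v}"
        using VUW by (subst card_Un_disjoint | intro finite_UnI fin fW fU fV | force)+
      finally show ?thesis by (simp only: swap)
    qed
    have e2: "card {(u,v)\<in>V\<times>V. adj u v \<and> c' u = c' v}
      = card {(u,v)\<in>W\<times>W. adj u v \<and> c u = c v} + card {(u,v)\<in>U\<times>U. adj u v}"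
    proof -
      have "{(u,v)\<in>V\<times>V. adj u v \<and> c' u = c' v}
        = {(u,v)\<in>W\<times>W. adj u v \<and> c u = c v} \<union> {(u,v)\<in>U\<times>U. adj u v}"
        by (auto simp: c'_def U_def ck' WV split: if_splits)
      also have "card \<dots> = card {(u,v)\<in>W\<times>W. adj u v \<and> c u = c v} + card {(u,v)\<in>U\<times>U. adj u v}"
        using VUW by (intro card_Un_disjoint fin fW fU) force
      finally show ?thesis .
    qed
    have e3: "card {(u,v)\<in>V\<times>V. c' u \<noteq> c' v}
      = card {(u,v)\<in>W\<times>W. c u \<noteq> c v} + 2 * (card U * card W)"
    proof -
      have "{(u,v)\<in>V\<times>V. c' u \<noteq> c' v}
        = ({(u,v)\<in>W\<times>W. c u \<noteq> c v} \<union> U \<times> W) \<union> W \<times> U"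
        by (auto simp: c'_def U_def ck' WV split: if_splits)
      also have "card \<dots> = card {(u,v)\<in>W\<times>W. c u \<noteq> c v} + card (U \<times> W) + card (W \<times> U)"
        using VUW
        by (subst card_Un_disjoint | intro finite_UnI finite_cartesian_product fin fW fU fV | force)+
      finally show ?thesis by (simp add: card_cartesian_product mult.commute)
    qed
    have e4: "card {(u,v)\<in>U\<times>W. adj u v} + card {(u,v)\<in>U\<times>U. adj u v} = card {(u,v)\<in>U\<times>V. adj u v}"
    proof -
      have "{(u,v)\<in>U\<times>V. adj u v} = {(u,v)\<in>U\<times>W. adj u v} \<union> {(u,v)\<in>U\<times>U. adj u v}"
        using VUW by auto
      also have "card \<dots> = card {(u,v)\<in>U\<times>W. adj u v} + card {(u,v)\<in>U\<times>U. adj u v}"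
        using VUW by (intro card_Un_disjoint fin fW fU) force
      finally show ?thesis ..
    qed
    have e5: "card {(u,v)\<in>U\<times>V. adj u v} \<le> card U * card W"
    proof -
      have "{(u,v)\<in>U\<times>V. adj u v} = Sigma U (\<lambda>u. {v\<in>V. adj u v})" by auto
      then have "card {(u,v)\<in>U\<times>V. adj u v} = (\<Sum>u\<in>U. deg u)"
        using fU fV by (simp add: deg_def)
      also have "\<dots> \<le> (\<Sum>u\<in>U. deg x)" by (intro sum_mono x) (auto simp: U_def)
      finally show ?thesis by (simp add: deg_def W_def)
    qed
    have "c' ` V \<subseteq> {..<Suc k}" by (auto simp: c'_def intro: less_SucI ck)
    \<comment> \<open>Write e(A, B) for the number of adjacent pairs in A x B. Passing from
      \<open>W\<close> to \<open>V\<close> adds e(U,W) + e(U,V) + e(U,U) = 2 e(U,V) on the left and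
      2 |U| |W| on the right, and \<open>e5\<close> compares the two.\<close>
    moreover have "card {(u,v)\<in>V\<times>V. adj u v} + card {(u,v)\<in>V\<times>V. adj u v \<and> c' u = c' v}
      \<le> card {(u,v)\<in>V\<times>V. c' u \<noteq> c' v}"
      using c(2) e1 e2 e3 e4 e5 by linarith
    ultimately show ?thesis by blast
  qed
qed

section \<open>Balancing a partition\<close>

text \<open>Inserting the vertices one at a time, always into a smallest part, preserves
  balance.\<close>

lemma equitable_partition_exists:
  assumes "finite R" "0 < k"
  shows "\<exists>P :: nat \<Rightarrow> 'a set. disjoint_family_on P {..<k} \<and> (\<Union>i<k. P i) = R \<and>
    (\<forall>i<k. \<forall>j<k. card (P i) \<le> card (P j) + 1)"
  using assms(1)
proof (induction R rule: finite_induct)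
  case empty
  show ?case by (intro exI[of _ "\<lambda>_. {}"]) (auto simp: disjoint_family_on_def)
next
  case (insert x R)
  then obtain P :: "nat \<Rightarrow> 'a set" where P: "disjoint_family_on P {..<k}" "(\<Union>i<k. P i) = R"
    "\<forall>i<k. \<forall>j<k. card (P i) \<le> card (P j) + 1" by blast
  obtain m where m: "m < k" "\<And>i. i < k \<Longrightarrow> card (P m) \<le> card (P i)"
    using ex_min_if_finite[of "(card \<circ> P) ` {..<k}"] assms(2)
    by (fastforce simp: not_less)
  have sub: "P i \<subseteq> R" if "i < k" for i using P(2) that by blast
  have fP: "finite (P i)" "x \<notin> P i" if "i < k" for i
    using sub[OF that] insert.hyps finite_subset by blast+
  define Q where "Q = P(m := insert x (P m))"
  have cQ: "card (Q i) = (if i = m then Suc (card (P m)) else card (P i))" if "i < k" for i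
    using fP[OF m(1)] by (simp add: Q_def)
  have "disjoint_family_on Q {..<k}"
    using P(1) fP(2) m(1) unfolding disjoint_family_on_def Q_def by auto
  moreover have "(\<Union>i<k. Q i) = insert x R"
    using P(2) m(1) by (auto simp: Q_def split: if_splits)
  moreover have "\<forall>i<k. \<forall>j<k. card (Q i) \<le> card (Q j) + 1"
    using P(3) m by (fastforce simp: cQ intro: le_SucI)
  ultimately show ?case by blast
qed

text \<open>Every class is trimmed to exactly \<open>m\<close> vertices, and the leftover set
  \<open>R\<close> is spread evenly over the trimmed classes. Only vertices of \<open>R\<close> can
  change class, so few move when \<open>m\<close> is close to \<open>card V / k\<close>.\<close>

lemma rebalance_partition:
  fixes c :: "'a \<Rightarrow> nat"
  assumes fin: "finite V" and c: "c ` V \<subseteq> {..<k}" and k: "0 < k"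
    and m: "\<And>i. i < k \<Longrightarrow> m \<le> card {v\<in>V. c v = i}"
  shows "\<exists>A R. disjoint_family_on A {..<k} \<and> (\<Union>i<k. A i) = V \<and>
    (\<forall>i<k. \<forall>j<k. card (A i) \<le> card (A j) + 1) \<and>
    R \<subseteq> V \<and> card R + k * m = card V \<and> (\<forall>i<k. \<forall>v\<in>A i. v \<in> R \<or> c v = i)"
proof -
  have "\<exists>B. B \<subseteq> {v\<in>V. c v = i} \<and> card B = m" if "i < k" for i
    using obtain_subset_with_card_n[OF m[OF that]] by metis
  then obtain B where B: "\<And>i. i < k \<Longrightarrow> B i \<subseteq> {v\<in>V. c v = i}" "\<And>i. i < k \<Longrightarrow> card (B i) = m"
    by metis
  define R where "R = V - (\<Union>i<k. B i)"
  have fB: "finite (B i)" if "i < k" for i using B(1)[OF that] fin by (auto intro: finite_subset)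
  have dB: "disjoint_family_on B {..<k}"
    using B(1) unfolding disjoint_family_on_def by blast
  have sB: "(\<Union>i<k. B i) \<subseteq> V" using B(1) by blast
  have cB: "card (\<Union>i<k. B i) = k * m"
    using fB B(2) dB by (subst card_UN_disjoint) (auto simp: disjoint_family_on_def)
  have cR: "card R + k * m = card V"
    using card_Diff_subset[OF _ sB] card_mono[OF fin sB] finite_subset[OF sB fin] cB
    by (simp add: R_def)
  obtain P :: "nat \<Rightarrow> 'a set" where P: "disjoint_family_on P {..<k}" "(\<Union>i<k. P i) = R"
    "\<forall>i<k. \<forall>j<k. card (P i) \<le> card (P j) + 1"
    using equitable_partition_exists[of R k] fin k by (auto simp: R_def)
  have PR: "P i \<subseteq> R" if "i < k" for i using P(2) that by blast
  have BP: "B i \<inter> P j = {}" if "i < k" "j < k" for i j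
    using PR[OF that(2)] that(1) by (auto simp: R_def)
  define A where "A = (\<lambda>i. B i \<union> P i)"
  have fP: "finite (P i)" if "i < k" for i
    using PR[OF that] fin by (auto simp: R_def intro: finite_subset)
  have cA: "card (A i) = m + card (P i)" if "i < k" for i
    unfolding A_def using card_Un_disjoint[OF fB fP BP] that B(2) by simp
  have "disjoint_family_on A {..<k}"
    unfolding disjoint_family_on_def A_def
  proof (intro ballI impI)
    fix i j assume ij: "i \<in> {..<k}" "j \<in> {..<k}" "i \<noteq> j"
    then have "B i \<inter> B j = {}" "P i \<inter> P j = {}" "B i \<inter> P j = {}" "B j \<inter> P i = {}"
      using dB P(1) BP by (auto simp: disjoint_family_on_def)
    then show "(B i \<union> P i) \<inter> (B j \<union> P j) = {}" by blast
  qed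
  moreover have "(\<Union>i<k. A i) = V"
  proof -
    have "(\<Union>i<k. A i) = (\<Union>i<k. B i) \<union> R" unfolding A_def using P(2) by blast
    then show ?thesis using sB by (auto simp: R_def)
  qed
  moreover have "\<forall>i<k. \<forall>j<k. card (A i) \<le> card (A j) + 1" using P(3) by (simp add: cA)
  moreover have "\<forall>i<k. \<forall>v\<in>A i. v \<in> R \<or> c v = i"
    using B(1) PR unfolding A_def by blast
  moreover have "R \<subseteq> V" by (auto simp: R_def)
  ultimately show ?thesis using cR by blast
qed

section \<open>Embedding expanded cliques\<close>

text \<open>For \<open>u = v\<close> these are the edges through one vertex; the cleaning below
  treats that case like any other pair.\<close>

definition pair_edges :: "'a set set \<Rightarrow> 'a \<Rightarrow> 'a \<Rightarrow> 'a set set" where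
  "pair_edges E u v = {e \<in> E. u \<in> e \<and> v \<in> e}"

lemma r_graph_finite_edges: "r_graph r V E \<Longrightarrow> finite E"
  by (rule finite_subset[of _ "Pow V"]) (auto simp: r_graph_def)

lemma card_supersets_le:
  assumes "finite V" "X \<subseteq> V" "card X \<le> r"
  shows "card {e. e \<subseteq> V \<and> card e = r \<and> X \<subseteq> e} \<le> card V ^ (r - card X)"
proof -
  have fX: "finite X" using assms finite_subset by blast
  have "card {e. e \<subseteq> V \<and> card e = r \<and> X \<subseteq> e} \<le> card {f. f \<subseteq> V \<and> card f = r - card X}"
  proof (rule card_inj_on_le[where f = "\<lambda>e. e - X"])
    show "inj_on (\<lambda>e. e - X) {e. e \<subseteq> V \<and> card e = r \<and> X \<subseteq> e}"
      by (rule inj_onI) auto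
    show "(\<lambda>e. e - X) ` {e. e \<subseteq> V \<and> card e = r \<and> X \<subseteq> e} \<subseteq> {f. f \<subseteq> V \<and> card f = r - card X}"
      using fX by (auto simp: card_Diff_subset)
  qed (use assms in auto)
  also have "\<dots> = card V choose (r - card X)" by (rule n_subsets[OF assms(1)])
  also have "\<dots> \<le> card V ^ (r - card X)"
    by (cases "r - card X \<le> card V") (auto intro: binomial_le_pow simp: binomial_eq_0)
  finally show ?thesis .
qed

lemma card_edges_superset_le:
  assumes "r_graph r V E" "X \<subseteq> V" "card X \<le> r"
  shows "card {e \<in> E. X \<subseteq> e} \<le> card V ^ (r - card X)"
proof -
  have fV: "finite V" using assms by (simp add: r_graph_def)
  have "card {e \<in> E. X \<subseteq> e} \<le> card {e. e \<subseteq> V \<and> card e = r \<and> X \<subseteq> e}"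
    using assms fV by (intro card_mono) (auto simp: r_graph_def)
  then show ?thesis using card_supersets_le[OF fV assms(2,3)] by simp
qed

text \<open>The cleaned edge set maximises the number of edges plus \<open>L\<close> times the number of uncovered
  pairs: removing the edges through a pair of codegree strictly between \<open>0\<close> and \<open>L\<close> would
  increase this quantity.\<close>
lemma exists_large_codegree_subgraph:
  assumes "r_graph r V E"
  shows "\<exists>E'\<subseteq>E. card (E - E') \<le> L * card V ^ 2 \<and>
    (\<forall>u\<in>V. \<forall>v\<in>V. pair_edges E' u v = {} \<or> L \<le> card (pair_edges E' u v))"
proof -
  have fV: "finite V" and fE: "finite E"
    using assms r_graph_finite_edges by (auto simp: r_graph_def)
  define Z where "Z = (\<lambda>F. {(u,v)\<in>V\<times>V. pair_edges F u v = {}})"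
  have fZ: "finite (Z F)" for F
    unfolding Z_def by (rule finite_subset[of _ "V \<times> V"]) (use fV in auto)
  define \<Phi> where "\<Phi> = (\<lambda>F. card F + L * card (Z F))"
  have "Max (\<Phi> ` Pow E) \<in> \<Phi> ` Pow E" using fE by (intro Max_in) auto
  then obtain E' where "E' \<subseteq> E" "\<Phi> E' = Max (\<Phi> ` Pow E)" by auto
  then have E': "E' \<subseteq> E" "\<And>F. F \<subseteq> E \<Longrightarrow> \<Phi> F \<le> \<Phi> E'"
    using fE by auto
  have fE': "finite E'" using E'(1) fE finite_subset by blast
  \<comment> \<open>Comparing the maximiser with \<open>E\<close> itself shows that the edges lost
    are paid for by uncovered ordered pairs, \<open>L\<close> for each.\<close>
  have "card E \<le> card E' + L * card (Z E')" using E'(2)[of E] by (simp add: \<Phi>_def)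
  moreover have "card (Z E') \<le> card (V \<times> V)"
    using fV by (intro card_mono) (auto simp: Z_def)
  then have "L * card (Z E') \<le> L * card V ^ 2"
    by (simp add: card_cartesian_product power2_eq_square)
  moreover have "card (E - E') = card E - card E'" by (rule card_Diff_subset[OF fE' E'(1)])
  ultimately have "card (E - E') \<le> L * card V ^ 2" by linarith
  moreover have "pair_edges E' u v = {} \<or> L \<le> card (pair_edges E' u v)" if uv: "u \<in> V" "v \<in> V" for u v
  proof (rule ccontr)
    assume a: "\<not> ?thesis"
    define F where "F = E' - pair_edges E' u v"
    have sub: "pair_edges E' u v \<subseteq> E'" by (auto simp: pair_edges_def)
    have "card F = card E' - card (pair_edges E' u v)"
      unfolding F_def using fE' sub by (intro card_Diff_subset) (auto intro: finite_subset)
    then have cF: "card E' < card F + L"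
      using a card_mono[OF fE' sub] by linarith
    have "insert (u,v) (Z E') \<subseteq> Z F" using uv by (auto simp: Z_def F_def pair_edges_def)
    then have "card (insert (u,v) (Z E')) \<le> card (Z F)" by (rule card_mono[OF fZ])
    moreover have "(u,v) \<notin> Z E'" using a by (simp add: Z_def)
    ultimately have "Suc (card (Z E')) \<le> card (Z F)" using fZ by simp
    then have "L * Suc (card (Z E')) \<le> L * card (Z F)" by (rule mult_le_mono2)
    then have "\<Phi> E' < \<Phi> F" using cF by (simp add: \<Phi>_def)
    moreover have "F \<subseteq> E" using E'(1) by (auto simp: F_def)
    ultimately show False using E'(2)[of F] by simp
  qed
  ultimately show ?thesis using E'(1) by blast
qed

lemma finite_clique_edges: "finite (clique_edges t)"
  unfolding clique_edges_def by auto

lemma card_clique_edges_le: "card (clique_edges t) \<le> t ^ 2"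
proof -
  have "card (clique_edges t) = t choose 2"
    unfolding clique_edges_def using n_subsets[of "{..<t}" 2] by simp
  also have "\<dots> \<le> t ^ 2"
    by (cases "2 \<le> t") (auto intro: binomial_le_pow simp: binomial_eq_0)
  finally show ?thesis .
qed

text \<open>The pairs of core vertices are served one by one, which is why the claim is made for
  subsets \<open>D\<close>. At each stage at most \<open>t + r * t ^ 2\<close> vertices are in use,
  and the codegree exceeds the number of edges through the pair that meet another used
  vertex.\<close>

lemma greedy_clique_expansion:
  fixes w :: "nat \<Rightarrow> 'a"
  assumes G: "r_graph r V E" and r: "3 \<le> r" and w: "inj_on w {..<t}" "w ` {..<t} \<subseteq> V"
    and cod: "\<And>i j. i < t \<Longrightarrow> j < t \<Longrightarrow> i \<noteq> j \<Longrightarrow>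
      (t + r * t ^ 2) * card V ^ (r - 3) < card (pair_edges E (w i) (w j))"
    and "D \<subseteq> clique_edges t"
  shows "\<exists>g. (\<forall>d\<in>D. g d \<in> E \<and> g d \<inter> w ` {..<t} = w ` d) \<and>
    (\<forall>d\<in>D. \<forall>d'\<in>D. d \<noteq> d' \<longrightarrow> g d \<inter> g d' \<subseteq> w ` {..<t})"
proof -
  have fV: "finite V" and fE: "finite E"
    using G r_graph_finite_edges by (auto simp: r_graph_def)
  have "finite D" using finite_subset[OF assms(6) finite_clique_edges] .
  then show ?thesis using assms(6)
  proof (induction D rule: finite_induct)
    case empty
    show ?case by simp
  next
    case (insert d D)
    let ?W = "w ` {..<t}"
    obtain g where g: "\<And>d. d \<in> D \<Longrightarrow> g d \<in> E" "\<And>d. d \<in> D \<Longrightarrow> g d \<inter> ?W = w ` d"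
      "\<And>d d'. d \<in> D \<Longrightarrow> d' \<in> D \<Longrightarrow> d \<noteq> d' \<Longrightarrow> g d \<inter> g d' \<subseteq> ?W"
      using insert by (metis insert_subset)
    have "d \<subseteq> {..<t}" "card d = 2" using insert.prems by (auto simp: clique_edges_def)
    then obtain a b where ab: "d = {a,b}" "a \<noteq> b" "a < t" "b < t" by (auto simp: card_2_iff)
    define u v where "u = w a" and "v = w b"
    have uv: "u \<noteq> v" "u \<in> V" "v \<in> V" "u \<in> ?W" "v \<in> ?W"
      using ab w by (auto simp: u_def v_def inj_on_def)
    define Z where "Z = ?W \<union> (\<Union>d\<in>D. g d)"
    have gV: "g d \<subseteq> V" "card (g d) = r" if "d \<in> D" for d
      using g(1)[OF that] G by (auto simp: r_graph_def)
    have ZV: "Z \<subseteq> V" using w gV by (auto simp: Z_def)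
    then have fZ: "finite Z" using fV finite_subset by blast
    have "card Z \<le> card ?W + card (\<Union>d\<in>D. g d)" unfolding Z_def by (rule card_Un_le)
    also have "card (\<Union>d\<in>D. g d) \<le> (\<Sum>d\<in>D. card (g d))"
      using insert.hyps(1) by (rule card_UN_le)
    also have "\<dots> = r * card D" using gV by simp
    also have "card D \<le> card (clique_edges t)"
      using insert.prems finite_clique_edges by (intro card_mono) auto
    also have "\<dots> \<le> t ^ 2" by (rule card_clique_edges_le)
    also have "card ?W \<le> t" using card_image_le[of "{..<t}" w] by simp
    finally have cZ: "card Z \<le> t + r * t ^ 2" by (simp add: mult_le_mono)
    \<comment> \<open>The unusable edges through \<open>u\<close> and \<open>v\<close>. For each
      used vertex \<open>z\<close> there are at most \<open>card V ^ (r - 3)\<close> of them, since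
      three vertices are prescribed.\<close>
    define Bad where "Bad = (\<Union>z\<in>Z - {u,v}. {e\<in>E. {u,v,z} \<subseteq> e})"
    have "card Bad \<le> (\<Sum>z\<in>Z - {u,v}. card {e\<in>E. {u,v,z} \<subseteq> e})"
      unfolding Bad_def using fZ by (intro card_UN_le) auto
    also have "\<dots> \<le> (\<Sum>z\<in>Z - {u,v}. card V ^ (r - 3))"
    proof (rule sum_mono)
      fix z assume z: "z \<in> Z - {u,v}"
      then have "card {u,v,z} = 3" using uv by auto
      then show "card {e\<in>E. {u,v,z} \<subseteq> e} \<le> card V ^ (r - 3)"
        using card_edges_superset_le[OF G, of "{u,v,z}"] uv z ZV r by auto
    qed
    also have "\<dots> \<le> card Z * card V ^ (r - 3)"
      using card_mono[OF fZ, of "Z - {u,v}"] by simp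
    also have "\<dots> \<le> (t + r * t ^ 2) * card V ^ (r - 3)" using cZ by simp
    also have "\<dots> < card (pair_edges E u v)" using cod[of a b] ab by (simp add: u_def v_def)
    finally have "card Bad < card (pair_edges E u v)" .
    moreover have "finite Bad" unfolding Bad_def using fE fZ by auto
    ultimately have "\<not> pair_edges E u v \<subseteq> Bad" using card_mono by (metis linorder_not_less)
    then obtain e where e: "e \<in> E" "u \<in> e" "v \<in> e" "e \<notin> Bad" by (auto simp: pair_edges_def)
    then have eZ: "e \<inter> Z \<subseteq> {u,v}" by (auto simp: Bad_def)
    have wd: "w ` d = {u,v}" using ab by (simp add: u_def v_def)
    define g' where "g' = g(d := e)"
    have g'D: "g' x = g x" if "x \<in> D" for x using insert.hyps(2) that by (auto simp: g'_def)
    have "e \<inter> ?W = w ` d" using eZ e uv wd by (auto simp: Z_def)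
    moreover have "e \<inter> g x \<subseteq> ?W" if "x \<in> D" for x
    proof -
      have "g x \<subseteq> Z" using that by (auto simp: Z_def)
      then show ?thesis using eZ uv by blast
    qed
    moreover have "g' d = e" by (simp add: g'_def)
    ultimately have "(\<forall>x\<in>insert d D. g' x \<in> E \<and> g' x \<inter> ?W = w ` x) \<and>
      (\<forall>x\<in>insert d D. \<forall>x'\<in>insert d D. x \<noteq> x' \<longrightarrow> g' x \<inter> g' x' \<subseteq> ?W)"
      using g e(1) g'D by (auto simp: Int_commute)
    then show ?case by (rule exI[of _ g'])
  qed
qed

text \<open>The core is mapped by \<open>w\<close>. The edge \<open>g d\<close> chosen for a pair
  meets the core in exactly that pair, so its other \<open>r - 2\<close> vertices can receive the
  new vertices of \<open>d\<close> through a bijection \<open>h d\<close>.\<close>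

lemma exp_clique_embedding:
  fixes w :: "nat \<Rightarrow> 'a"
  assumes G: "r_graph r V E" and r: "3 \<le> r" and w: "inj_on w {..<t}" "w ` {..<t} \<subseteq> V"
    and cod: "\<And>i j. i < t \<Longrightarrow> j < t \<Longrightarrow> i \<noteq> j \<Longrightarrow>
      (t + r * t ^ 2) * card V ^ (r - 3) < card (pair_edges E (w i) (w j))"
  shows "\<not> hypergraph_free (exp_clique_verts r t) (exp_clique_edges r t) V E"
proof -
  let ?W = "w ` {..<t}" and ?D = "clique_edges t"
  obtain g where g: "\<And>d. d \<in> ?D \<Longrightarrow> g d \<in> E" "\<And>d. d \<in> ?D \<Longrightarrow> g d \<inter> ?W = w ` d"
    "\<And>d d'. d \<in> ?D \<Longrightarrow> d' \<in> ?D \<Longrightarrow> d \<noteq> d' \<Longrightarrow> g d \<inter> g d' \<subseteq> ?W"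
    using greedy_clique_expansion[OF G r w cod order_refl] by metis
  have gV: "g d \<subseteq> V" "card (g d) = r" "finite (g d)" if "d \<in> ?D" for d
    using g(1)[OF that] G by (auto simp: r_graph_def intro: finite_subset)
  have "\<exists>h. bij_betw h {..<r - 2} (g d - ?W)" if d: "d \<in> ?D" for d
  proof -
    have dt: "d \<subseteq> {..<t}" "card d = 2" using d by (auto simp: clique_edges_def)
    have "card (w ` d) = 2" using dt w(1) by (metis card_image inj_on_subset)
    then have "card (g d - ?W) = r - 2"
      using gV[OF d] g(2)[OF d] by (metis card_Diff_subset_Int finite_Int)
    then show ?thesis using gV(3)[OF d]
      by (metis finite_Diff finite_lessThan card_lessThan finite_same_card_bij)
  qed
  then obtain h where h: "\<And>d. d \<in> ?D \<Longrightarrow> bij_betw (h d) {..<r - 2} (g d - ?W)" by metis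
  define f where "f = case_sum w (\<lambda>(d, j). h d j)"
  have hin: "h d j \<in> g d" "h d j \<notin> ?W" if "d \<in> ?D" "j < r - 2" for d j
    using h[OF that(1)] that(2) by (auto simp: bij_betw_def)
  have inj: "inj_on f (exp_clique_verts r t)"
  proof (rule inj_onI)
    fix x y assume x: "x \<in> exp_clique_verts r t" and y: "y \<in> exp_clique_verts r t" and e: "f x = f y"
    consider i j where "x = Inl i" "y = Inl j" "i < t" "j < t"
      | i d j where "x = Inl i" "y = Inr (d,j)" "i < t" "d \<in> ?D" "j < r - 2"
      | i d j where "y = Inl i" "x = Inr (d,j)" "i < t" "d \<in> ?D" "j < r - 2"
      | d j d' j' where "x = Inr (d,j)" "y = Inr (d',j')" "d \<in> ?D" "j < r - 2" "d' \<in> ?D" "j' < r - 2"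
      using x y unfolding exp_clique_verts_def by blast
    then show "x = y"
    proof cases
      case 1
      then show ?thesis using e w(1) by (auto simp: f_def inj_on_def)
    next
      case 2
      then have "h d j = w i" using e by (simp add: f_def)
      then show ?thesis using hin(2)[of d j] 2 by blast
    next
      case 3
      then have "h d j = w i" using e by (simp add: f_def)
      then show ?thesis using hin(2)[of d j] 3 by blast
    next
      case 4
      then have eq: "h d j = h d' j'" using e by (simp add: f_def)
      \<comment> \<open>Edges chosen for different pairs meet only inside the core, whereas the
        values of \<open>h\<close> lie outside it.\<close>
      have "d = d'"
      proof (rule ccontr)
        assume "d \<noteq> d'"
        then show False using g(3)[of d d'] hin[of d j] hin[of d' j'] 4 eq by auto
      qed
      moreover have "j = j'"
        using h[of d] eq \<open>d = d'\<close> 4 by (auto simp: bij_betw_def inj_on_def)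
      ultimately show ?thesis using 4 by simp
    qed
  qed
  have im: "f ` (Inl ` d \<union> (\<lambda>j. Inr (d, j)) ` {..<r - 2}) = g d" if d: "d \<in> ?D" for d
  proof -
    have "f ` (Inl ` d \<union> (\<lambda>j. Inr (d, j)) ` {..<r - 2}) = w ` d \<union> h d ` {..<r - 2}"
      by (auto simp: f_def image_Un image_image)
    also have "h d ` {..<r - 2} = g d - ?W" using h[OF d] by (simp add: bij_betw_def)
    finally show ?thesis using g(2)[OF d] by auto
  qed
  have imE: "(`) f ` exp_clique_edges r t = g ` ?D"
    unfolding exp_clique_edges_def image_image by (intro image_cong refl im)
  have sub: "f ` exp_clique_verts r t \<subseteq> V"
  proof -
    have "h d j \<in> V" if "d \<in> ?D" "j < r - 2" for d j using hin(1)[OF that] gV(1)[OF that(1)] by blast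
    then show ?thesis using w(2) by (auto simp: exp_clique_verts_def f_def)
  qed
  have "e \<subseteq> f ` exp_clique_verts r t" if e: "e \<in> g ` ?D" for e
  proof -
    obtain d where d: "d \<in> ?D" "e = g d" using e by blast
    have "Inl ` d \<union> (\<lambda>j. Inr (d, j)) ` {..<r - 2} \<subseteq> exp_clique_verts r t"
      using d(1) by (auto simp: exp_clique_verts_def clique_edges_def)
    then show ?thesis using im[OF d(1)] d(2) by blast
  qed
  then have "subgraph (f ` exp_clique_verts r t) (g ` ?D) V E"
    unfolding subgraph_def using sub g(1) by blast
  moreover have "hypergraph_iso (exp_clique_verts r t) (exp_clique_edges r t)
      (f ` exp_clique_verts r t) (g ` ?D)"
    unfolding hypergraph_iso_def using inj imE by (auto simp: bij_betw_def)
  ultimately show ?thesis unfolding hypergraph_free_def by blast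
qed

definition shadow :: "'a set set \<Rightarrow> 'a \<Rightarrow> 'a \<Rightarrow> bool" where
  "shadow E u v \<longleftrightarrow> u \<noteq> v \<and> (\<exists>e\<in>E. u \<in> e \<and> v \<in> e)"

text \<open>A codegree threshold of order \<open>card V ^ (r - 3)\<close> costs only order
  \<open>card V ^ (r - 1)\<close> edges, yet suffices to expand any \<open>t\<close>-clique of the
  remaining shadow inside \<open>E\<close>.\<close>

lemma exp_clique_free_cleanup:
  assumes G: "r_graph r V E" and r: "3 \<le> r" and n: "V \<noteq> {}"
    and free: "hypergraph_free (exp_clique_verts r t) (exp_clique_edges r t) V E"
  shows "\<exists>E'\<subseteq>E. card (E - E') \<le> (t + r * t ^ 2 + 1) * card V ^ (r - 1) \<and>
    cliques (shadow E') V t = {}"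
proof -
  \<comment> \<open>The embedding needs codegrees strictly above the first summand, hence the
    \<open>+ 1\<close>.\<close>
  define L where "L = (t + r * t ^ 2) * card V ^ (r - 3) + 1"
  obtain E' where E': "E' \<subseteq> E" "card (E - E') \<le> L * card V ^ 2"
    "\<And>u v. u \<in> V \<Longrightarrow> v \<in> V \<Longrightarrow> pair_edges E' u v = {} \<or> L \<le> card (pair_edges E' u v)"
    using exists_large_codegree_subgraph[OF G, of L] by metis
  have G': "r_graph r V E'" using G E'(1) by (auto simp: r_graph_def)
  have fV: "finite V" using G by (simp add: r_graph_def)
  have "1 \<le> card V" using n fV by (simp add: Suc_leI card_gt_0_iff)
  then have "1 \<le> card V ^ (r - 3)" by simp
  then have "L \<le> (t + r * t ^ 2 + 1) * card V ^ (r - 3)" by (simp add: L_def)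
  then have "L * card V ^ 2 \<le> (t + r * t ^ 2 + 1) * card V ^ (r - 3) * card V ^ 2" by (rule mult_le_mono1)
  also have "\<dots> = (t + r * t ^ 2 + 1) * card V ^ (r - 3 + 2)"
    by (simp only: power_add mult.assoc)
  also have "r - 3 + 2 = r - 1" using r by simp
  finally have "card (E - E') \<le> (t + r * t ^ 2 + 1) * card V ^ (r - 1)" using E'(2) by simp
  moreover have "cliques (shadow E') V t = {}"
  proof (rule ccontr)
    assume "cliques (shadow E') V t \<noteq> {}"
    then obtain S where S: "S \<subseteq> V" "card S = t" "\<And>u v. u \<in> S \<Longrightarrow> v \<in> S \<Longrightarrow> u \<noteq> v \<Longrightarrow> shadow E' u v"
      by (auto simp: cliques_def)
    obtain w where w: "bij_betw w {..<t} S"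
      using finite_same_card_bij[of "{..<t}" S] S(2) finite_subset[OF S(1) fV] by auto
    have cod: "(t + r * t ^ 2) * card V ^ (r - 3) < card (pair_edges E (w i) (w j))"
      if "i < t" "j < t" "i \<noteq> j" for i j
    proof -
      have wS: "w i \<in> S" "w j \<in> S" "w i \<noteq> w j" using w that by (auto simp: bij_betw_def inj_on_def)
      then have "pair_edges E' (w i) (w j) \<noteq> {}"
        using S(3) by (auto simp: shadow_def pair_edges_def)
      then have "L \<le> card (pair_edges E' (w i) (w j))" using E'(3) wS S(1) by blast
      also have "\<dots> \<le> card (pair_edges E (w i) (w j))"
        using E'(1) r_graph_finite_edges[OF G] by (intro card_mono) (auto simp: pair_edges_def)
      finally show ?thesis by (simp add: L_def)
    qed
    have "inj_on w {..<t}" "w ` {..<t} \<subseteq> V" using w S(1) by (auto simp: bij_betw_def)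
    from exp_clique_embedding[OF G r this cod] free show False by blast
  qed
  ultimately show ?thesis using E'(1) by blast
qed

section \<open>Stability in terms of edges\<close>

lemma two_card_edges:
  assumes fin: "finite V" and sym: "\<And>u v. adj u v \<Longrightarrow> adj v u" and irrefl: "\<And>u. \<not> adj u u"
  shows "card {(u,v)\<in>V\<times>V. adj u v} = 2 * card (cliques adj V 2)"
proof -
  have c1: "cliques adj V 1 = (\<lambda>v. {v}) ` V"
    by (auto simp: cliques_def card_1_singleton_iff)
  have cn: "common_nbrs adj V {v} = {u\<in>V. adj v u}" for v
    using irrefl by (auto simp: common_nbrs_def)
  have "{(u,v)\<in>V\<times>V. adj u v} = Sigma V (\<lambda>u. {v\<in>V. adj u v})" by auto
  then have "card {(u,v)\<in>V\<times>V. adj u v} = (\<Sum>u\<in>V. card {v\<in>V. adj u v})"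
    using fin by simp
  also have "\<dots> = (\<Sum>T\<in>cliques adj V 1. card (common_nbrs adj V T))"
    unfolding c1 by (subst sum.reindex) (auto simp: cn)
  also have "\<dots> = (\<Sum>A\<in>cliques adj V (Suc 1). \<Sum>a\<in>A. 1)"
    using sum_cliques_Suc[of V adj "\<lambda>_ _. 1::nat" 1, OF fin sym] by simp
  also have "\<dots> = (\<Sum>A\<in>cliques adj V 2. 2)"
    by (intro sum.cong) (auto simp: cliques_def numeral_2_eq_2)
  finally show ?thesis by simp
qed

lemma card_same_colour_pairs:
  fixes c :: "'a \<Rightarrow> nat"
  assumes fin: "finite V" and c: "c ` V \<subseteq> {..<k}"
  shows "card {(u,v)\<in>V\<times>V. c u = c v} = (\<Sum>i<k. (card {v\<in>V. c v = i})\<^sup>2)"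
    and "card V = (\<Sum>i<k. card {v\<in>V. c v = i})"
proof -
  have "{(u,v)\<in>V\<times>V. c u = c v} = (\<Union>i<k. {v\<in>V. c v = i} \<times> {v\<in>V. c v = i})"
    using c by auto
  also have "card \<dots> = (\<Sum>i<k. card ({v\<in>V. c v = i} \<times> {v\<in>V. c v = i}))"
    using fin by (intro card_UN_disjoint) auto
  finally show "card {(u,v)\<in>V\<times>V. c u = c v} = (\<Sum>i<k. (card {v\<in>V. c v = i})\<^sup>2)"
    by (simp add: card_cartesian_product power2_eq_square)
  have "V = (\<Union>i<k. {v\<in>V. c v = i})" using c by auto
  then have "card V = card (\<Union>i<k. {v\<in>V. c v = i})" by simp
  also have "\<dots> = (\<Sum>i<k. card {v\<in>V. c v = i})"
    using fin by (intro card_UN_disjoint) auto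
  finally show "card V = (\<Sum>i<k. card {v\<in>V. c v = i})" .
qed

text \<open>For Furedi's colouring, twice the number of edges plus the number \<open>M\<close> of
  monochromatic adjacent pairs plus the sum of the squared class sizes is at most n^2. That sum of
  squares is n^2/k plus the total squared deviation from n/k, so near-extremality leaves only
  \<gamma> n^2 for \<open>M\<close> and the deviation together.\<close>

lemma near_extremal_partition:
  fixes adj :: "'a \<Rightarrow> 'a \<Rightarrow> bool" and \<gamma> :: real
  assumes fin: "finite V" and sym: "\<And>u v. adj u v \<Longrightarrow> adj v u" and irrefl: "\<And>u. \<not> adj u u"
    and free: "cliques adj V (Suc k) = {}" and k: "0 < k" and \<gamma>: "0 \<le> \<gamma>"
    and many: "(1 - \<gamma>) * (1 - 1 / real k) * (real (card V))\<^sup>2 \<le> 2 * real (card (cliques adj V 2))"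
  shows "\<exists>c. c ` V \<subseteq> {..<k} \<and>
    real (card {(u,v)\<in>V\<times>V. adj u v \<and> c u = c v}) \<le> \<gamma> * (real (card V))\<^sup>2 \<and>
    (\<forall>i<k. real (card V) / real k - sqrt \<gamma> * real (card V) \<le> real (card {v\<in>V. c v = i}))"
proof -
  obtain c where c: "c ` V \<subseteq> {..<k}"
    "card {(u,v)\<in>V\<times>V. adj u v} + card {(u,v)\<in>V\<times>V. adj u v \<and> c u = c v}
      \<le> card {(u,v)\<in>V\<times>V. c u \<noteq> c v}"
    using furedi_partition[OF sym irrefl fin free] by blast
  define n where "n = real (card V)"
  define a where "a = (\<lambda>i. real (card {v\<in>V. c v = i}))"
  define M where "M = real (card {(u,v)\<in>V\<times>V. adj u v \<and> c u = c v})"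
  have "V \<times> V = {(u,v)\<in>V\<times>V. c u \<noteq> c v} \<union> {(u,v)\<in>V\<times>V. c u = c v}" by auto
  then have "card (V \<times> V) = card ({(u,v)\<in>V\<times>V. c u \<noteq> c v} \<union> {(u,v)\<in>V\<times>V. c u = c v})"
    by (rule arg_cong)
  also have "\<dots> = card {(u,v)\<in>V\<times>V. c u \<noteq> c v} + card {(u,v)\<in>V\<times>V. c u = c v}"
  proof (rule card_Un_disjoint)
    show "finite {(u,v)\<in>V\<times>V. c u \<noteq> c v}" "finite {(u,v)\<in>V\<times>V. c u = c v}"
      using fin by (auto intro: finite_subset[of _ "V \<times> V"])
  qed auto
  finally have "2 * card (cliques adj V 2) + card {(u,v)\<in>V\<times>V. adj u v \<and> c u = c v}
      + (\<Sum>i<k. (card {v\<in>V. c v = i})\<^sup>2) \<le> card V ^ 2"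
    using c(2) two_card_edges[of V adj, OF fin sym irrefl] card_same_colour_pairs(1)[OF fin c(1)]
      card_cartesian_product[of V V] power2_eq_square[of "card V"] by linarith
  then have "real (2 * card (cliques adj V 2) + card {(u,v)\<in>V\<times>V. adj u v \<and> c u = c v}
      + (\<Sum>i<k. (card {v\<in>V. c v = i})\<^sup>2)) \<le> real (card V ^ 2)"
    by (rule of_nat_mono)
  then have main: "2 * real (card (cliques adj V 2)) + M + (\<Sum>i<k. (a i)\<^sup>2) \<le> n\<^sup>2"
    by (simp add: M_def a_def n_def)
  have sa: "(\<Sum>i<k. a i) = n"
    unfolding a_def n_def using card_same_colour_pairs(2)[OF fin c(1)] by simp
  have "(\<Sum>i<k. (a i - n / k)\<^sup>2) = (\<Sum>i<k. (a i)\<^sup>2) - 2 * (n / k) * (\<Sum>i<k. a i) + k * (n / k)\<^sup>2"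
    by (simp add: power2_diff sum.distrib sum_subtractf sum_distrib_left sum_divide_distrib mult_ac)
  also have "\<dots> = (\<Sum>i<k. (a i)\<^sup>2) - n\<^sup>2 / k"
    using k by (simp add: sa power2_eq_square field_simps)
  finally have var: "(\<Sum>i<k. (a i - n / k)\<^sup>2) = (\<Sum>i<k. (a i)\<^sup>2) - n\<^sup>2 / k" .
  have "(1 - \<gamma>) * (1 - 1 / real k) * n\<^sup>2 = n\<^sup>2 - n\<^sup>2 / k - \<gamma> * (1 - 1 / real k) * n\<^sup>2"
    by (simp add: algebra_simps diff_divide_distrib)
  moreover have "\<gamma> * (1 - 1 / real k) * n\<^sup>2 \<le> \<gamma> * 1 * n\<^sup>2"
    using \<gamma> k by (intro mult_right_mono mult_left_mono) auto
  \<comment> \<open>Both conclusions follow from this one bound: \<open>M\<close> directly, and each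
    class size by taking the root of its own term of the sum.\<close>
  ultimately have bnd: "(\<Sum>i<k. (a i - n / k)\<^sup>2) + M \<le> \<gamma> * n\<^sup>2"
    using main many var by (simp add: n_def)
  have "M \<le> \<gamma> * n\<^sup>2" using bnd sum_nonneg[of "{..<k}" "\<lambda>i. (a i - n / k)\<^sup>2"] by simp
  moreover have "n / k - sqrt \<gamma> * n \<le> a i" if i: "i < k" for i
  proof -
    have "(n / k - a i)\<^sup>2 \<le> (\<Sum>i<k. (a i - n / k)\<^sup>2)"
      using member_le_sum[of i "{..<k}" "\<lambda>i. (a i - n / k)\<^sup>2"] i by (simp add: power2_commute)
    also have "\<dots> \<le> (sqrt \<gamma> * n)\<^sup>2"
      using bnd \<gamma> by (simp add: power_mult_distrib M_def)
    finally have "n / k - a i \<le> sqrt \<gamma> * n"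
      by (rule power2_le_imp_le) (use \<gamma> in \<open>simp add: n_def\<close>)
    then show ?thesis by simp
  qed
  ultimately show ?thesis using c(1) unfolding M_def n_def a_def by blast
qed

text \<open>The edges are \<open>r\<close>-cliques of the complete \<open>k\<close>-partite graph on
  the parts \<open>A i\<close>, which has no \<open>(k + 1)\<close>-clique by pigeonhole, so the
  clique bound with unit weights applies.\<close>

lemma card_turan_graph_le:
  assumes "is_turan_graph r k V T" "finite V" "0 < k" "r \<le> k"
  shows "real (card T) \<le> turan_density k r * real (card V) ^ r"
proof -
  obtain A :: "nat \<Rightarrow> 'a set" where A: "(\<Union>i<k. A i) = V"
    and T: "T = {e. e \<subseteq> V \<and> card e = r \<and> (\<forall>i<k. card (e \<inter> A i) \<le> 1)}"
    using assms(1) unfolding is_turan_graph_def by blast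
  define adj where "adj = (\<lambda>u v. \<forall>i<k. \<not> (u \<in> A i \<and> v \<in> A i))"
  interpret weighted_graph V adj "\<lambda>_. 1" by unfold_locales (auto simp: adj_def assms(2))
  have "cliques adj V (Suc k) = {}"
  proof (rule ccontr)
    assume "cliques adj V (Suc k) \<noteq> {}"
    then obtain S where S: "S \<subseteq> V" "card S = Suc k" "\<And>u v. u \<in> S \<Longrightarrow> v \<in> S \<Longrightarrow> u \<noteq> v \<Longrightarrow> adj u v"
      by (auto simp: cliques_def)
    have "\<forall>v\<in>S. \<exists>i<k. v \<in> A i" using S(1) A by blast
    then obtain f where f: "\<And>v. v \<in> S \<Longrightarrow> f v < k \<and> v \<in> A (f v)" by metis
    have "inj_on f S"
    proof (rule inj_onI, rule ccontr)
      fix u v assume "u \<in> S" "v \<in> S" "f u = f v" "u \<noteq> v"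
      then show False using S(3)[of u v] f[of u] f[of v] by (auto simp: adj_def)
    qed
    then have "card S \<le> card {..<k}" using f by (intro card_inj_on_le) auto
    then show False using S(2) by simp
  qed
  moreover have "T \<subseteq> cliques adj V r"
  proof
    fix e assume "e \<in> T"
    then have e: "e \<subseteq> V" "card e = r" "\<And>i. i < k \<Longrightarrow> card (e \<inter> A i) \<le> 1" by (auto simp: T)
    have fe: "finite e" using e(1) assms(2) finite_subset by blast
    have "adj u v" if uv: "u \<in> e" "v \<in> e" "u \<noteq> v" for u v
      unfolding adj_def
    proof (intro allI impI notI)
      fix i assume "i < k" "u \<in> A i \<and> v \<in> A i"
      then have "card {u,v} \<le> card (e \<inter> A i)" using uv fe by (intro card_mono) auto
      then show False using e(3)[OF \<open>i < k\<close>] uv by simp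
    qed
    then show "e \<in> cliques adj V r" using e by (auto simp: cliques_def)
  qed
  then have "card T \<le> card (cliques adj V r)" by (rule card_mono[OF finite_cliques[OF assms(2)]])
  ultimately show ?thesis
    using clique_weight_le_turan[of k r] assms by (simp add: clique_weight_one)
qed

lemma shadow_sym: "shadow E u v \<Longrightarrow> shadow E v u"
  by (auto simp: shadow_def)

lemma shadow_irrefl: "\<not> shadow E u u"
  by (simp add: shadow_def)

lemma edges_subset_cliques_shadow:
  assumes "r_graph r V E"
  shows "E \<subseteq> cliques (shadow E) V r"
  using assms by (auto simp: cliques_def r_graph_def shadow_def)

text \<open>The edges are \<open>r\<close>-cliques of the shadow, so the Moon-Moser ratios between
  levels 2 and \<open>r\<close> force the shadow to have nearly as many edges as the Turan graph.
  Its near-extremal partition, once rebalanced, defines \<open>T\<close>.\<close>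

lemma edge_stability:
  fixes \<gamma> :: real
  assumes G: "r_graph r V E" and free: "cliques (shadow E) V (Suc k) = {}"
    and r: "2 \<le> r" "r \<le> k" and V: "V \<noteq> {}" and \<gamma>: "0 \<le> \<gamma>"
    and many: "(1 - \<gamma>) * (turan_density k r * real (card V) ^ r) \<le> real (card E)"
  shows "\<exists>T. is_turan_graph r k V T \<and>
    real (card (E - T)) \<le> (real k * sqrt \<gamma> + \<gamma>) * real (card V) ^ r"
proof -
  have fV: "finite V" and fE: "finite E" using G r_graph_finite_edges by (auto simp: r_graph_def)
  have k: "0 < k" using r by simp
  define n where "n = real (card V)"
  have n: "0 < n" using V fV by (simp add: n_def card_gt_0_iff)
  interpret weighted_graph V "shadow E" "\<lambda>_. 1"
    by unfold_locales (auto simp: fV shadow_sym)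
  define q where "q = (\<lambda>i. (real k - real i) / (real (Suc i) * real k) * n)"
  define P where "P = (\<Prod>i=2..<r. q i)"
  have P: "0 < P" unfolding P_def q_def using r k n by (intro prod_pos) auto
  \<comment> \<open>The factor \<open>P\<close> that bounds \<open>r\<close>-cliques by edges also
    relates the two Turan densities; it cancels, and the loss factor \<open>1 - \<gamma>\<close> is
    unchanged.\<close>
  have split: "turan_density k r * n ^ r = P * (turan_density k 2 * n ^ 2)"
  proof -
    have "(\<Prod>i<r. q i) = (\<Prod>i<2. q i) * P"
      unfolding P_def using r prod.atLeastLessThan_concat[of 0 2 r q] by (simp add: atLeast0LessThan)
    then show ?thesis using turan_density_eq[of k n r] turan_density_eq[of k n 2]
      by (simp add: q_def mult.commute)
  qed
  have "real (card E) \<le> real (card (cliques (shadow E) V r))"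
    using card_mono[OF finite_cliques[OF fV] edges_subset_cliques_shadow[OF G]] by simp
  also have "\<dots> \<le> P * real (card (cliques (shadow E) V 2))"
    using clique_weight_le[OF free k, of 2 r] r by (simp add: clique_weight_one P_def q_def n_def)
  finally have "P * ((1 - \<gamma>) * (turan_density k 2 * n\<^sup>2)) \<le> P * real (card (cliques (shadow E) V 2))"
    using many split by (simp add: n_def mult.left_commute)
  then have "(1 - \<gamma>) * (turan_density k 2 * n\<^sup>2) \<le> real (card (cliques (shadow E) V 2))"
    using P by simp
  moreover have "2 * turan_density k 2 = 1 - 1 / real k"
    using k by (simp add: turan_density_def falling_fact_def numeral_2_eq_2 power2_eq_square field_simps)
  ultimately have "(1 - \<gamma>) * (1 - 1 / real k) * n\<^sup>2 \<le> 2 * real (card (cliques (shadow E) V 2))"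

  proof -
    assume le: "(1 - \<gamma>) * (turan_density k 2 * n\<^sup>2) \<le> real (card (cliques (shadow E) V 2))"
      and eq: "2 * turan_density k 2 = 1 - 1 / real k"
    have "(1 - \<gamma>) * (1 - 1 / real k) * n\<^sup>2 = 2 * ((1 - \<gamma>) * (turan_density k 2 * n\<^sup>2))"
      unfolding eq[symmetric] by simp
    then show ?thesis using le by linarith
  qed
  then obtain c where c: "c ` V \<subseteq> {..<k}"
    "real (card {(u,v)\<in>V\<times>V. shadow E u v \<and> c u = c v}) \<le> \<gamma> * n\<^sup>2"
    "\<And>i. i < k \<Longrightarrow> n / real k - sqrt \<gamma> * n \<le> real (card {v\<in>V. c v = i})"
    using near_extremal_partition[OF fV shadow_sym shadow_irrefl free k \<gamma>] unfolding n_def by blast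
  define m where "m = Min ((\<lambda>i. card {v\<in>V. c v = i}) ` {..<k})"
  have "m \<in> (\<lambda>i. card {v\<in>V. c v = i}) ` {..<k}" unfolding m_def using k by (intro Min_in) auto
  then have m1: "n / real k - sqrt \<gamma> * n \<le> real m" using c(3) by auto
  have m2: "m \<le> card {v\<in>V. c v = i}" if "i < k" for i unfolding m_def using that by auto
  obtain A R where A: "disjoint_family_on A {..<k}" "(\<Union>i<k. A i) = V"
    "\<forall>i<k. \<forall>j<k. card (A i) \<le> card (A j) + 1"
    and R: "R \<subseteq> V" "card R + k * m = card V" "\<And>i v. i < k \<Longrightarrow> v \<in> A i \<Longrightarrow> v \<in> R \<or> c v = i"
    using rebalance_partition[OF fV c(1) k m2] by metis
  define T where "T = {e. e \<subseteq> V \<and> card e = r \<and> (\<forall>i<k. card (e \<inter> A i) \<le> 1)}"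
  have T: "is_turan_graph r k V T" unfolding is_turan_graph_def T_def using A by blast
  \<comment> \<open>Since \<open>R\<close> has \<open>card V - k * m\<close> vertices, a lower bound
    on the smallest class size \<open>m\<close> bounds the number of moved vertices.\<close>
  have "k * (n / real k - sqrt \<gamma> * n) \<le> k * real m" using m1 by (intro mult_left_mono) auto
  moreover have "real (card R) + k * real m = n" using R(2) unfolding n_def by (metis of_nat_add of_nat_mult)
  ultimately have cR: "real (card R) \<le> k * sqrt \<gamma> * n"
    using k by (simp add: right_diff_distrib)
  define M where "M = {(u,v)\<in>V\<times>V. shadow E u v \<and> c u = c v}"
  have fM: "finite M" unfolding M_def by (rule finite_subset[of _ "V \<times> V"]) (use fV in auto)
  have fR: "finite R" using R(1) fV finite_subset by blast
  let ?X = "\<Union>v\<in>R. {e\<in>E. {v} \<subseteq> e}" and ?Y = "\<Union>x\<in>M. {e\<in>E. {fst x, snd x} \<subseteq> e}"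
  \<comment> \<open>An edge outside \<open>T\<close> has two vertices in one part. Either one of
    them was moved, or the two form a shadow pair that is monochromatic under
    \<open>c\<close>.\<close>
  have "E - T \<subseteq> ?X \<union> ?Y"
  proof
    fix e assume e: "e \<in> E - T"
    then have eV: "e \<subseteq> V" "card e = r" using G by (auto simp: r_graph_def)
    then obtain i where i: "i < k" "\<not> card (e \<inter> A i) \<le> 1" using e by (auto simp: T_def)
    have "finite (e \<inter> A i)" using eV(1) fV finite_subset by blast
    then obtain u v where uv: "u \<in> e \<inter> A i" "v \<in> e \<inter> A i" "u \<noteq> v"
      using i(2) card_le_Suc0_iff_eq[of "e \<inter> A i"] by auto
    show "e \<in> ?X \<union> ?Y"
    proof (cases "u \<in> R \<or> v \<in> R")
      case True
      then show ?thesis using uv e by auto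
    next
      case False
      then have "c u = c v" using R(3)[OF i(1)] uv by (metis IntD2)
      then have "(u,v) \<in> M" using uv e eV(1) by (auto simp: M_def shadow_def)
      then show ?thesis using uv e by force
    qed
  qed
  then have "card (E - T) \<le> card (?X \<union> ?Y)"
    using fE fM fR by (intro card_mono) auto
  also have "\<dots> \<le> card ?X + card ?Y" by (rule card_Un_le)
  also have "card ?X \<le> (\<Sum>v\<in>R. card {e\<in>E. {v} \<subseteq> e})" by (rule card_UN_le[OF fR])
  also have "\<dots> \<le> (\<Sum>v\<in>R. card V ^ (r - 1))"
  proof (rule sum_mono)
    fix v assume "v \<in> R"
    then show "card {e\<in>E. {v} \<subseteq> e} \<le> card V ^ (r - 1)"
      using card_edges_superset_le[OF G, of "{v}"] R(1) r by auto
  qed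
  also have "card ?Y \<le> (\<Sum>x\<in>M. card {e\<in>E. {fst x, snd x} \<subseteq> e})" by (rule card_UN_le[OF fM])
  also have "\<dots> \<le> (\<Sum>x\<in>M. card V ^ (r - 2))"
  proof (rule sum_mono)
    fix x assume "x \<in> M"
    then have "fst x \<in> V" "snd x \<in> V" "card {fst x, snd x} = 2" by (auto simp: M_def shadow_def)
    then show "card {e\<in>E. {fst x, snd x} \<subseteq> e} \<le> card V ^ (r - 2)"
      using card_edges_superset_le[OF G, of "{fst x, snd x}"] r by auto
  qed
  finally have "card (E - T) \<le> card R * card V ^ (r - 1) + card M * card V ^ (r - 2)" by simp
  then have "real (card (E - T)) \<le> real (card R * card V ^ (r - 1) + card M * card V ^ (r - 2))"
    by (rule of_nat_mono)
  also have "\<dots> = real (card R) * n ^ (r - 1) + real (card M) * n ^ (r - 2)"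
    by (simp add: n_def)
  also have "\<dots> \<le> (k * sqrt \<gamma> * n) * n ^ (r - 1) + (\<gamma> * n\<^sup>2) * n ^ (r - 2)"
    using cR c(2) n by (intro add_mono mult_right_mono) (auto simp: M_def)
  also have "\<dots> = k * sqrt \<gamma> * n ^ (1 + (r - 1)) + \<gamma> * n ^ (2 + (r - 2))"
    by (simp only: power_add power_one_right mult.assoc)
  also have "1 + (r - 1) = r" using r by simp
  also have "2 + (r - 2) = r" using r by simp
  also have "k * sqrt \<gamma> * n ^ r + \<gamma> * n ^ r = (real k * sqrt \<gamma> + \<gamma>) * n ^ r" by (simp add: distrib_right)
  finally show ?thesis using T unfolding n_def by blast
qed

section \<open>Spectral stability\<close>

text \<open>Hoelder's inequality against the constant function 1, obtained from the convexity of the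
  \<open>p\<close>-th power.\<close>

lemma sum_le_card_powr_sum_powr:
  fixes a :: "'b \<Rightarrow> real"
  assumes fin: "finite D" and a: "\<And>e. e \<in> D \<Longrightarrow> 0 \<le> a e" and p: "1 < p"
  shows "sum a D \<le> real (card D) powr (1 - 1 / p) * (\<Sum>e\<in>D. a e powr p) powr (1 / p)"
proof -
  \<comment> \<open>Zero terms are set aside so that convexity is applied to positive numbers
    only.\<close>
  define D' where "D' = {e\<in>D. 0 < a e}"
  have fD': "finite D'" using fin by (simp add: D'_def)
  show ?thesis
  proof (cases "D' = {}")
    case True
    then have "\<And>e. e \<in> D \<Longrightarrow> a e = 0" using a by (force simp: D'_def)
    then show ?thesis by simp
  next
    case False
    define N where "N = real (card D')"
    have N: "0 < N" using False fD' by (simp add: N_def card_gt_0_iff)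
    define S where "S = (\<Sum>e\<in>D'. a e powr p)"
    have "(\<Sum>e\<in>D'. (1 / N) *\<^sub>R a e) powr p \<le> (\<Sum>e\<in>D'. (1 / N) * a e powr p)"
      using p N by (intro convex_on_sum[OF fD' False powr_convex]) (auto simp: D'_def N_def)
    then have "(sum a D' / N) powr p \<le> S / N"
      by (simp add: S_def sum_divide_distrib)
    then have "((sum a D' / N) powr p) powr (1 / p) \<le> (S / N) powr (1 / p)"
      using p by (intro powr_mono2) auto
    moreover have sD': "0 \<le> sum a D'" using a by (intro sum_nonneg) (auto simp: D'_def)
    ultimately have "sum a D' / N \<le> (S / N) powr (1 / p)"
      using p N by (simp add: powr_powr)
    also have "\<dots> = S powr (1 / p) / N powr (1 / p)"
      using N by (simp add: powr_divide S_def sum_nonneg)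
    finally have "sum a D' \<le> N * (S powr (1 / p) / N powr (1 / p))"
      using N by (simp add: field_simps)
    also have "\<dots> = N powr (1 - 1 / p) * S powr (1 / p)"
      using N by (simp add: powr_diff)
    also have "\<dots> \<le> real (card D) powr (1 - 1 / p) * (\<Sum>e\<in>D. a e powr p) powr (1 / p)"
    proof (intro mult_mono powr_mono2)
      show "N \<le> real (card D)" unfolding N_def using fin by (auto simp: D'_def intro: card_mono)
      show "S \<le> (\<Sum>e\<in>D. a e powr p)"
        unfolding S_def using fin by (intro sum_mono2) (auto simp: D'_def)
    qed (use p N in \<open>auto simp: S_def sum_nonneg\<close>)
    also have "sum a D' = sum a D"
      using a fin by (intro sum.mono_neutral_left) (force simp: D'_def)+
    finally show ?thesis .
  qed
qed

text \<open>After Hoelder's inequality the \<open>p\<close>-th powers of the edge products are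
  clique products for the weights \<open>\<bar>x v\<bar> powr p\<close>, so a bound \<open>C\<close>
  on the clique weight of any graph covering \<open>D\<close> can be used.\<close>

lemma sum_prod_edges_le:
  fixes x :: "'a \<Rightarrow> real"
  assumes fV: "finite V" and D: "D \<subseteq> cliques adj V r" and p: "1 < p"
    and C: "clique_weight adj V (\<lambda>v. \<bar>x v\<bar> powr p) r \<le> C"
  shows "(\<Sum>e\<in>D. \<Prod>v\<in>e. \<bar>x v\<bar>) \<le> real (card D) powr (1 - 1 / p) * C powr (1 / p)"
proof -
  have fD: "finite D" using D finite_cliques[OF fV] finite_subset by blast
  have "(\<Sum>e\<in>D. (\<Prod>v\<in>e. \<bar>x v\<bar>) powr p) = (\<Sum>e\<in>D. \<Prod>v\<in>e. \<bar>x v\<bar> powr p)"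
    by (intro sum.cong refl prod_powr_distrib)
  also have "\<dots> \<le> clique_weight adj V (\<lambda>v. \<bar>x v\<bar> powr p) r"
    unfolding clique_weight_def using D finite_cliques[OF fV]
    by (intro sum_mono2 prod_nonneg) auto
  finally have "(\<Sum>e\<in>D. (\<Prod>v\<in>e. \<bar>x v\<bar>) powr p) \<le> C" using C by simp
  then have "(\<Sum>e\<in>D. (\<Prod>v\<in>e. \<bar>x v\<bar>) powr p) powr (1 / p) \<le> C powr (1 / p)"
    using p by (intro powr_mono2 sum_nonneg) auto
  then have "real (card D) powr (1 - 1 / p) * (\<Sum>e\<in>D. (\<Prod>v\<in>e. \<bar>x v\<bar>) powr p) powr (1 / p)
      \<le> real (card D) powr (1 - 1 / p) * C powr (1 / p)"
    by (rule mult_left_mono) simp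
  moreover have "(\<Sum>e\<in>D. \<Prod>v\<in>e. \<bar>x v\<bar>)
      \<le> real (card D) powr (1 - 1 / p) * (\<Sum>e\<in>D. (\<Prod>v\<in>e. \<bar>x v\<bar>) powr p) powr (1 / p)"
    by (rule sum_le_card_powr_sum_powr[OF fD _ p]) (auto intro: prod_nonneg)
  ultimately show ?thesis by linarith
qed

text \<open>For a maximising vector the weights \<open>\<bar>x v\<bar> powr p\<close> have sum 1.
  The kept edges lie in a graph without \<open>(k + 1)\<close>-cliques and get the Turan density;
  the deleted ones lie in the complete graph and get the crude bound 1.\<close>

lemma p_spectral_radius_le:
  assumes p: "1 < p" and G: "r_graph r V E" and V: "V \<noteq> {}" and r: "r \<le> k" "0 < k"
    and E': "E' \<subseteq> E" and free: "cliques (shadow E') V (Suc k) = {}"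
  shows "p_spectral_radius p r V E \<le> fact r *
    (real (card E') powr (1 - 1 / p) * turan_density k r powr (1 / p)
      + real (card (E - E')) powr (1 - 1 / p))"
proof -
  have fV: "finite V" and fE: "finite E" using G r_graph_finite_edges by (auto simp: r_graph_def)
  have G': "r_graph r V E'" using G E' by (auto simp: r_graph_def)
  obtain x where x: "lp_norm_on V p x = 1" "poly_form r E x = p_spectral_radius p r V E"
    using p_spectral_radius_attained[OF _ G V, of p] p by (metis less_imp_le)
  have s1: "(\<Sum>v\<in>V. \<bar>x v\<bar> powr p) = 1" using x(1) p by (simp add: lp_norm_on_eq_1_iff)
  have "(\<Sum>e\<in>E. \<Prod>v\<in>e. x v) \<le> (\<Sum>e\<in>E. \<Prod>v\<in>e. \<bar>x v\<bar>)"
    by (intro sum_mono) (metis abs_ge_self abs_prod)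
  also have "\<dots> = (\<Sum>e\<in>E'. \<Prod>v\<in>e. \<bar>x v\<bar>) + (\<Sum>e\<in>E - E'. \<Prod>v\<in>e. \<bar>x v\<bar>)"
    using sum.subset_diff[OF E' fE] by (simp add: add.commute)
  also have "(\<Sum>e\<in>E'. \<Prod>v\<in>e. \<bar>x v\<bar>) \<le> real (card E') powr (1 - 1 / p) * turan_density k r powr (1 / p)"
  proof (rule sum_prod_edges_le[where adj = "shadow E'", OF fV edges_subset_cliques_shadow[OF G'] p])
    interpret weighted_graph V "shadow E'" "\<lambda>v. \<bar>x v\<bar> powr p"
      by unfold_locales (auto simp: fV shadow_sym)
    show "clique_weight (shadow E') V (\<lambda>v. \<bar>x v\<bar> powr p) r \<le> turan_density k r"
      using clique_weight_le_turan[OF free r(2,1)] by (simp add: s1)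
  qed
  also have "(\<Sum>e\<in>E - E'. \<Prod>v\<in>e. \<bar>x v\<bar>) \<le> real (card (E - E')) powr (1 - 1 / p) * 1 powr (1 / p)"
  proof (rule sum_prod_edges_le[where adj = "\<lambda>_ _. True", OF fV _ p])
    show "E - E' \<subseteq> cliques (\<lambda>_ _. True) V r" using G by (auto simp: cliques_def r_graph_def)
    interpret weighted_graph V "\<lambda>_ _. True" "\<lambda>v. \<bar>x v\<bar> powr p"
      by unfold_locales (auto simp: fV)
    show "clique_weight (\<lambda>_ _. True) V (\<lambda>v. \<bar>x v\<bar> powr p) r \<le> 1"
      using clique_weight_le_power[of r] by (simp add: s1)
  qed
  finally have "(\<Sum>e\<in>E. \<Prod>v\<in>e. x v) \<le> real (card E') powr (1 - 1 / p) * turan_density k r powr (1 / p)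
      + real (card (E - E')) powr (1 - 1 / p)" by simp
  then show ?thesis unfolding x(2)[symmetric] poly_form_def by (intro mult_left_mono) auto
qed

lemma turan_density_le_1:
  assumes "r \<le> k"
  shows "turan_density k r \<le> 1"
proof -
  have "falling_fact k r \<le> (\<Prod>i<r. real k)"
    unfolding falling_fact_def using assms by (intro prod_mono) auto
  also have "\<dots> = 1 * real k ^ r" by simp
  also have "\<dots> \<le> fact r * real k ^ r" by (intro mult_right_mono fact_ge_1) auto
  finally show ?thesis unfolding turan_density_def by (intro divide_le_eq_1[THEN iffD2]) auto
qed

text \<open>With q = 1 - 1/p > 0, too few edges in \<open>E'\<close> would scale the main term by
  \<open>(1 - \<gamma>) powr q\<close>. The deleted edges contribute a term smaller by a factor of
  order n^q, which is where \<open>p > 1\<close> enters.\<close>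

lemma many_edges_of_large_p_spectral_radius:
  fixes \<gamma> \<delta> K p :: real
  assumes p: "1 < p" and G: "r_graph r V E" and V: "V \<noteq> {}" and r: "1 \<le> r" "r \<le> k"
    and E': "E' \<subseteq> E" "cliques (shadow E') V (Suc k) = {}"
    and D: "real (card (E - E')) \<le> K * real (card V) ^ (r - 1)" and K: "0 \<le> K"
    and \<gamma>: "\<gamma> < 1" and \<delta>: "2 * \<delta> = 1 - (1 - \<gamma>) powr (1 - 1 / p)"
    and n: "K powr (1 - 1 / p) \<le> \<delta> * turan_density k r * real (card V) powr (1 - 1 / p)"
    and large: "(1 - \<delta>) * (falling_fact k r / real k ^ r) * real (card V) powr (real r * (1 - 1 / p))
      < p_spectral_radius p r V E"
  shows "(1 - \<gamma>) * (turan_density k r * real (card V) ^ r) \<le> real (card E')"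
proof (rule ccontr)
  assume "\<not> ?thesis"
  then have less: "real (card E') \<le> (1 - \<gamma>) * (turan_density k r * real (card V) ^ r)" by simp
  define q where "q = 1 - 1 / p"
  define N where "N = real (card V)"
  define td where "td = turan_density k r"
  have q: "0 < q" using p by (simp add: q_def)
  have fV: "finite V" using G by (simp add: r_graph_def)
  have N: "0 < N" using V fV by (simp add: N_def card_gt_0_iff)
  have k: "0 < k" using r by simp
  have td: "0 < td" using turan_density_pos[OF r(2) k] by (simp add: td_def)
  have pw: "(N ^ s) powr q = N powr (real s * q)" for s
    using N by (simp add: powr_realpow[symmetric] powr_powr)
  have "real (card E') powr q \<le> ((1 - \<gamma>) * (td * N ^ r)) powr q"
    using less q by (intro powr_mono2) (auto simp: td_def N_def)
  also have "\<dots> = (1 - \<gamma>) powr q * td powr q * N powr (real r * q)"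
    using \<gamma> td N by (simp add: powr_mult pw)
  finally have "real (card E') powr q * td powr (1 / p)
      \<le> (1 - \<gamma>) powr q * td powr q * N powr (real r * q) * td powr (1 / p)"
    by (rule mult_right_mono) simp
  also have "\<dots> = (1 - \<gamma>) powr q * (td powr q * td powr (1 / p)) * N powr (real r * q)"
    by simp
  also have "td powr q * td powr (1 / p) = td"
    using td by (simp add: powr_add[symmetric] q_def)
  finally have b1: "real (card E') powr q * td powr (1 / p) \<le> (1 - \<gamma>) powr q * td * N powr (real r * q)" .
  have "real (card (E - E')) powr q \<le> (K * N ^ (r - 1)) powr q"
    using D q by (intro powr_mono2) (auto simp: N_def)
  also have "\<dots> = K powr q * N powr (real (r - 1) * q)"
    using K N by (simp add: powr_mult pw)
  also have "\<dots> \<le> \<delta> * td * N powr q * N powr (real (r - 1) * q)"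
    using n by (intro mult_right_mono) (auto simp: q_def td_def N_def)
  also have "\<dots> = \<delta> * td * N powr (q + real (r - 1) * q)"
    by (simp add: powr_add)
  also have "q + real (r - 1) * q = real r * q" using r by (simp add: of_nat_diff algebra_simps)
  finally have b2: "real (card (E - E')) powr q \<le> \<delta> * td * N powr (real r * q)" .
  have "p_spectral_radius p r V E \<le> fact r *
      (real (card E') powr q * td powr (1 / p) + real (card (E - E')) powr q)"
    using p_spectral_radius_le[OF p G V r(2) k E'] by (simp add: q_def td_def)
  also have "\<dots> \<le> fact r * ((1 - \<gamma>) powr q * td * N powr (real r * q) + \<delta> * td * N powr (real r * q))"
    by (intro mult_left_mono add_mono b1 b2) simp
  also have "\<dots> = ((1 - \<gamma>) powr q + \<delta>) * (fact r * td) * N powr (real r * q)"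
    by (simp add: algebra_simps)
  \<comment> \<open>The gap \<open>1 - (1 - \<gamma>) powr q\<close> equals
    \<open>2 * \<delta>\<close>: one half absorbs the deleted edges, the other contradicts
    \<open>large\<close>.\<close>
  also have "(1 - \<gamma>) powr q + \<delta> = 1 - \<delta>" using \<delta> by (simp add: q_def)
  also have "fact r * td = falling_fact k r / real k ^ r" by (simp add: td_def turan_density_def)
  finally show False using large by (simp add: q_def N_def)
qed

section \<open>Edit distance to the Turan graph\<close>

text \<open>Edge stability controls only \<open>E - T\<close>; the missing edges
  \<open>T - E\<close> are then bounded by counting, as \<open>T\<close> is not much larger than
  \<open>E\<close>. The deficiency is taken as a square so that its root in
  \<open>edge_stability\<close> becomes \<open>\<eta>\<close>.\<close>

lemma turan_distance_le:
  fixes \<eta> K :: real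
  assumes G: "r_graph r V E" and V: "V \<noteq> {}" and r: "2 \<le> r" "r \<le> k"
    and E': "E' \<subseteq> E" "cliques (shadow E') V (Suc k) = {}"
    and D: "real (card (E - E')) \<le> K * real (card V) ^ (r - 1)"
    and \<eta>: "0 \<le> \<eta>" "\<eta> \<le> 1"
    and many: "(1 - \<eta>\<^sup>2) * (turan_density k r * real (card V) ^ r) \<le> real (card E')"
  shows "\<exists>T. is_turan_graph r k V T \<and> real (card ((E - T) \<union> (T - E)))
    \<le> real (2 * k + 3) * \<eta> * real (card V) ^ r + 2 * K * real (card V) ^ (r - 1)"
proof -
  have fV: "finite V" and fE: "finite E" using G r_graph_finite_edges by (auto simp: r_graph_def)
  have G': "r_graph r V E'" using G E' by (auto simp: r_graph_def)
  define N where "N = real (card V)"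
  have N: "0 \<le> N" by (simp add: N_def)
  obtain T where T: "is_turan_graph r k V T"
    and ET: "real (card (E' - T)) \<le> (real k * sqrt (\<eta>\<^sup>2) + \<eta>\<^sup>2) * N ^ r"
    using edge_stability[OF G' E'(2) r V _ many] by (auto simp: N_def)
  have sq: "\<eta>\<^sup>2 \<le> \<eta>" using \<eta> by (simp add: power2_eq_square mult_left_le_one_le)
  have "(real k * sqrt (\<eta>\<^sup>2) + \<eta>\<^sup>2) * N ^ r \<le> (real k * \<eta> + \<eta>) * N ^ r"
    using sq \<eta> N by (intro mult_right_mono add_mono) auto
  then have ET': "real (card (E' - T)) \<le> (real k * \<eta> + \<eta>) * N ^ r" using ET by simp
  have fT: "finite T" using T fV
    by (auto simp: is_turan_graph_def intro: finite_subset[of _ "Pow V"])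
  have "card (E - T) \<le> card ((E' - T) \<union> (E - E'))"
    using fE E'(1) finite_subset[OF E'(1) fE] by (intro card_mono) auto
  also have "\<dots> \<le> card (E' - T) + card (E - E')" by (rule card_Un_le)
  finally have "real (card (E - T)) \<le> real (card (E' - T) + card (E - E'))" by (rule of_nat_mono)
  then have c1: "real (card (E - T)) \<le> (real k * \<eta> + \<eta>) * N ^ r + K * N ^ (r - 1)"
    using ET' D by (simp add: N_def)
  have "card E = card (E \<inter> T) + card (E - T)" "card T = card (E \<inter> T) + card (T - E)"
    using card_Int_Diff[OF fE, of T] card_Int_Diff[OF fT, of E] by (simp_all add: Int_commute)
  then have cTE: "real (card (T - E)) = real (card T) - real (card E) + real (card (E - T))" by simp
  have cEE: "real (card E') \<le> real (card E)" using card_mono[OF fE E'(1)] by simp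
  have cT: "real (card T) \<le> turan_density k r * N ^ r"
    using card_turan_graph_le[OF T fV _ r(2)] r by (simp add: N_def)
  have "\<eta>\<^sup>2 * (turan_density k r * N ^ r) \<le> \<eta> * (1 * N ^ r)"
    using \<eta> sq turan_density_le_1[OF r(2)] turan_density_pos[OF r(2)] r N
    by (intro mult_mono mult_right_mono) auto
  then have "real (card T) - real (card E) \<le> \<eta> * N ^ r"
    using cT cEE many unfolding N_def[symmetric] by (simp add: left_diff_distrib)
  moreover have "real (card ((E - T) \<union> (T - E))) \<le> real (card (E - T)) + real (card (T - E))"
    using card_Un_le[of "E - T" "T - E"] by (metis of_nat_add of_nat_mono)
  ultimately have "real (card ((E - T) \<union> (T - E))) \<le> \<eta> * N ^ r + 2 * real (card (E - T))"
    using cTE by linarith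
  also have "\<dots> \<le> \<eta> * N ^ r + 2 * ((real k * \<eta> + \<eta>) * N ^ r + K * N ^ (r - 1))"
    using c1 by simp
  also have "\<dots> = real (2 * k + 3) * \<eta> * N ^ r + 2 * K * N ^ (r - 1)"
    by (simp add: algebra_simps)
  finally show ?thesis using T unfolding N_def by blast
qed

theorem theorem3p1:
  fixes p :: real and k r :: nat and \<epsilon> :: real
  assumes "p > 1" and "r \<ge> 3" and "k \<ge> r" and "\<epsilon> > 0"
  shows "\<exists>\<delta>::real. \<exists>n0::nat. \<delta> > 0 \<and>
    (\<forall>n > n0. \<forall>(V :: nat set) E.
      r_graph r V E \<and> card V = n \<and>
      hypergraph_free (exp_clique_verts r (k + 1)) (exp_clique_edges r (k + 1)) V E \<and>
      p_spectral_radius p r V E >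
        (1 - \<delta>) * (falling_fact k r / real k ^ r) * real n powr (real r * (1 - 1 / p)) \<longrightarrow>
      (\<exists>T. is_turan_graph r k V T \<and>
        real (card ((E - T) \<union> (T - E))) \<le> \<epsilon> * real (n choose r)))"
proof -
  define q where "q = 1 - 1 / p"
  have q: "0 < q" using assms by (simp add: q_def)
  define td where "td = turan_density k r"
  have td: "0 < td" using turan_density_pos[of r k] assms by (simp add: td_def)
  \<comment> \<open>The cleaning constant for cliques of size \<open>t = k + 1\<close>.\<close>
  define K where "K = real ((k + 1) + r * (k + 1) ^ 2 + 1)"
  have K: "0 \<le> K" by (simp add: K_def)
  \<comment> \<open>The second entry makes the main error at most half of
    \<open>\<epsilon> * (n / r) ^ r\<close>; the first keeps \<open>\<eta>\<^sup>2\<close> below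
    1.\<close>
  define \<eta> where "\<eta> = min (1 / 2) (\<epsilon> / (2 * real (2 * k + 3) * real r ^ r))"
  have rr: "0 < real r ^ r" using assms by simp
  have \<eta>: "0 < \<eta>" "\<eta> \<le> 1 / 2" "\<eta> \<le> \<epsilon> / (2 * real (2 * k + 3) * real r ^ r)"
    using assms rr unfolding \<eta>_def by (simp_all only: min.cobounded1 min.cobounded2) auto
  have \<eta>2: "0 < \<eta>\<^sup>2" "\<eta>\<^sup>2 < 1"
    using \<eta> by (auto intro: power_less_one_iff[THEN iffD2] simp: power_less_one_iff)
  define \<delta> where "\<delta> = (1 - (1 - \<eta>\<^sup>2) powr q) / 2"
  have \<delta>: "0 < \<delta>" using powr_less_mono2[of q "1 - \<eta>\<^sup>2" 1] \<eta>2 q by (simp add: \<delta>_def)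
  \<comment> \<open>The first entry makes the \<open>2 * K * n ^ (r - 1)\<close> error at most the
    other half of \<open>\<epsilon> * (n / r) ^ r\<close>; the second makes the spectral
    contribution of the deleted edges small enough.\<close>
  define b where "b = max (4 * K * real r ^ r / \<epsilon>) ((K powr q / (\<delta> * td)) powr (1 / q))"
  \<comment> \<open>Taking \<open>n0\<close> at least \<open>r\<close> ensures \<open>r < n\<close>,
    so \<open>V\<close> is nonempty and \<open>(n / r) ^ r\<close> is at most
    \<open>n choose r\<close>.\<close>
  define n0 where "n0 = max r (nat \<lceil>b\<rceil>)"
  have "\<exists>T. is_turan_graph r k V T \<and> real (card ((E - T) \<union> (T - E))) \<le> \<epsilon> * real (n choose r)"
    if n: "n > n0" and H: "r_graph r V E" "card V = n"
      "hypergraph_free (exp_clique_verts r (k + 1)) (exp_clique_edges r (k + 1)) V E"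
      "p_spectral_radius p r V E > (1 - \<delta>) * (falling_fact k r / real k ^ r) * real n powr (real r * (1 - 1 / p))"
    for n and V :: "nat set" and E
  proof -
    have nr: "r < n" and "b \<le> real n" using n by (auto simp: n0_def) linarith
    then have n1: "4 * K * real r ^ r / \<epsilon> \<le> real n" and n2: "(K powr q / (\<delta> * td)) powr (1 / q) \<le> real n"
      by (auto simp: b_def)
    have V: "V \<noteq> {}" using nr H(2) by auto
    obtain E' where E': "E' \<subseteq> E" "cliques (shadow E') V (Suc k) = {}"
      "card (E - E') \<le> ((k + 1) + r * (k + 1) ^ 2 + 1) * card V ^ (r - 1)"
      using exp_clique_free_cleanup[OF H(1) assms(2) V H(3)] by auto
    have "real (card (E - E')) \<le> real (((k + 1) + r * (k + 1) ^ 2 + 1) * card V ^ (r - 1))"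
      using E'(3) by (rule of_nat_mono)
    then have D: "real (card (E - E')) \<le> K * real (card V) ^ (r - 1)"
      by (simp only: K_def of_nat_mult of_nat_power)
    have "((K powr q / (\<delta> * td)) powr (1 / q)) powr q \<le> real n powr q"
      using n2 q by (intro powr_mono2) auto
    then have "K powr q / (\<delta> * td) \<le> real n powr q"
      using q \<delta> td by (simp add: powr_powr)
    then have n3: "K powr q \<le> \<delta> * td * real n powr q"
      using \<delta> td by (simp add: field_simps)
    have "(1 - \<eta>\<^sup>2) * (turan_density k r * real (card V) ^ r) \<le> real (card E')"
    proof (rule many_edges_of_large_p_spectral_radius[OF assms(1) H(1) V _ assms(3) E'(1,2) D K])
      show "2 * \<delta> = 1 - (1 - \<eta>\<^sup>2) powr (1 - 1 / p)" by (simp add: \<delta>_def q_def)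
    qed (use assms \<eta>2 n3 H in \<open>auto simp: td_def q_def\<close>)
    then obtain T where T: "is_turan_graph r k V T" "real (card ((E - T) \<union> (T - E)))
        \<le> real (2 * k + 3) * \<eta> * real n ^ r + 2 * K * real n ^ (r - 1)"
      using turan_distance_le[OF H(1) V _ assms(3) E'(1,2) D, of \<eta>] \<eta> assms(2) H(2) by auto
    have t1: "real (2 * k + 3) * \<eta> \<le> \<epsilon> / (2 * real r ^ r)"
    proof -
      have "real (2 * k + 3) * \<eta> \<le> real (2 * k + 3) * (\<epsilon> / (2 * real (2 * k + 3) * real r ^ r))"
        by (intro mult_left_mono \<eta>(3)) simp
      then show ?thesis by (simp del: of_nat_add of_nat_mult)
    qed
    have "2 * K \<le> \<epsilon> / (2 * real r ^ r) * real n"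
      using n1 assms(4) rr by (simp add: field_simps)
    then have "2 * K * real n ^ (r - 1) \<le> \<epsilon> / (2 * real r ^ r) * real n * real n ^ (r - 1)"
      by (rule mult_right_mono) simp
    also have "\<dots> = \<epsilon> / (2 * real r ^ r) * real n ^ r"
      using assms(2) by (simp add: power_eq_if)
    finally have "real (card ((E - T) \<union> (T - E)))
        \<le> \<epsilon> / (2 * real r ^ r) * real n ^ r + \<epsilon> / (2 * real r ^ r) * real n ^ r"
      using T(2) mult_right_mono[OF t1, of "real n ^ r"] by simp
    also have "\<dots> = \<epsilon> * (real n / real r) ^ r" by (simp add: power_divide)
    also have "\<dots> \<le> \<epsilon> * real (n choose r)"
      using binomial_ge_n_over_k_pow_k[of r n, where 'a = real] nr assms(4)
      by (intro mult_left_mono) auto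
    finally show ?thesis using T(1) by blast
  qed
  then show ?thesis using \<delta> by (intro exI[of _ \<delta>] exI[of _ n0]) blast
qed

end
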